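(* Let $\Omega\subset D=[0,1]^n$ be a bounded domain, let $\mathcal{D}$ be a direction set, and let $g:\mathbb{R}^n\to\mathbb{R}$ be continuous. Assume there exists a continuous function $g_0:\mathbb{R}^n\to\mathbb{R}$ which is $\mathcal{D}$-convex on $\mathbb{R}^n$, with $g\ge g_0$ in $\Omega$ and $g=g_0$ on $D\setminus\Omega$. Let $u\in USC(\Omega)$ be a viscosity subsolution and $v\in LSC(\Omega)$ a viscosity supersolution of $$\max\{u(x)-g(x),\,-\lambda_{\mathcal{D}}(D^2u(x))\}=0\quad\text{in }\Omega.$$ If $u\le v$ on $\partial\Omega$, then $u\le v$ on $\Omega$.
   Context: A set $\mathcal{D}\subset\mathbb{R}^n$ is a direction set if its span is $\mathbb{R}^n$, it is symmetric ($d\in\mathcal{D}\Rightarrow -d\in\mathcal{D}$), and $0\notin\mathcal{D}$. A continuous $u:\mathbb{R}^n\to\mathbb{R}$ is $\mathcal{D}$-convex if $u(\lambda x+(1-\lambda)y)\le\lambda u(x)+(1-\lambda)u(y)$ for all $\lambda\in[0,1]$ and all $x,y$ with $x-y\in\mathcal{D}$. For a symmetric matrix $M$, $\lambda_{\mathcal{D}}(M)=\inf_{v\in\mathcal{D}}\frac{v^\intercal M v}{|v|^2}$. An upper semicontinuous $u$ is a viscosity subsolution of the equation if for every $C^2$ function $\phi$ and every point $x\in\Omega$ at which $u-\phi$ has a local maximum, $u(x)-g(x)\le 0$ and $-\lambda_{\mathcal{D}}(D^2\phi(x))\le 0$. A lower semicontinuous $u$ is a viscosity supersolution if for every $C^2$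 function $\phi$ and every $x\in\Omega$ at which $u-\phi$ has a local minimum, $u(x)-g(x)\ge0$ or $-\lambda_{\mathcal{D}}(D^2\phi(x))\ge0$. $USC$ and $LSC$ denote upper and lower semicontinuous functions.
   Formalization: u and v are taken upper resp. lower semicontinuous on the closure of Ω rather than only on Ω; otherwise u≤v on ∂Ω has no force (e.g. Ω=(0,1), g=g_0=0, u=0, v=−1 in Ω and v=0 on ∂Ω is a counterexample). *)

theory Defs
  imports "HOL-Analysis.Analysis"
begin

definition direction_set :: "(real^'n) set \<Rightarrow> bool" where
  "direction_set Dirs \<longleftrightarrow> span Dirs = UNIV \<and> (\<forall>d\<in>Dirs. - d \<in> Dirs) \<and> 0 \<notin> Dirs"

definition D_convex :: "(real^'n) set \<Rightarrow> (real^'n \<Rightarrow> real) \<Rightarrow> bool" where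
  "D_convex Dirs u \<longleftrightarrow> continuous_on UNIV u \<and>
     (\<forall>x y t. x - y \<in> Dirs \<longrightarrow> 0 \<le> t \<longrightarrow> t \<le> 1 \<longrightarrow>
        u (t *\<^sub>R x + (1 - t) *\<^sub>R y) \<le> t * u x + (1 - t) * u y)"

definition lambdaD :: "(real^'n) set \<Rightarrow> real^'n^'n \<Rightarrow> real" where
  "lambdaD Dirs M = (INF v\<in>Dirs. (v \<bullet> (M *v v)) / (norm v)\<^sup>2)"

text \<open>phi is C^2 on R^n with gradient Dphi and Hessian matrix H (H continuous).
  By uniqueness of derivatives, H x is the Hessian D^2 phi(x).\<close>
definition C2_with_hessian :: "(real^'n \<Rightarrow> real) \<Rightarrow> (real^'n \<Rightarrow> real^'n) \<Rightarrow> (real^'n \<Rightarrow> real^'n^'n) \<Rightarrow> bool" where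
  "C2_with_hessian \<phi> D\<phi> H \<longleftrightarrow>
     (\<forall>x. (\<phi> has_derivative (\<lambda>h. D\<phi> x \<bullet> h)) (at x)) \<and>
     (\<forall>x. (D\<phi> has_derivative (\<lambda>h. H x *v h)) (at x)) \<and>
     continuous_on UNIV H"

definition usc_on :: "(real^'n) set \<Rightarrow> (real^'n \<Rightarrow> real) \<Rightarrow> bool" where
  "usc_on S u \<longleftrightarrow> (\<forall>x\<in>S. \<forall>e>0. \<exists>d>0. \<forall>y\<in>S. dist y x < d \<longrightarrow> u y < u x + e)"

definition lsc_on :: "(real^'n) set \<Rightarrow> (real^'n \<Rightarrow> real) \<Rightarrow> bool" where
  "lsc_on S u \<longleftrightarrow> (\<forall>x\<in>S. \<forall>e>0. \<exists>d>0. \<forall>y\<in>S. dist y x < d \<longrightarrow> u x - e < u y)"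

definition local_max_on :: "(real^'n) set \<Rightarrow> (real^'n \<Rightarrow> real) \<Rightarrow> real^'n \<Rightarrow> bool" where
  "local_max_on S f x \<longleftrightarrow> (\<exists>r>0. \<forall>y\<in>S. dist y x < r \<longrightarrow> f y \<le> f x)"

definition local_min_on :: "(real^'n) set \<Rightarrow> (real^'n \<Rightarrow> real) \<Rightarrow> real^'n \<Rightarrow> bool" where
  "local_min_on S f x \<longleftrightarrow> (\<exists>r>0. \<forall>y\<in>S. dist y x < r \<longrightarrow> f x \<le> f y)"

definition visc_subsolution :: "(real^'n) set \<Rightarrow> (real^'n \<Rightarrow> real) \<Rightarrow> (real^'n) set \<Rightarrow> (real^'n \<Rightarrow> real) \<Rightarrow> bool" where
  "visc_subsolution Dirs g \<Omega> u \<longleftrightarrow> usc_on \<Omega> u \<and>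
     (\<forall>\<phi> D\<phi> H x. C2_with_hessian \<phi> D\<phi> H \<longrightarrow> x \<in> \<Omega> \<longrightarrow> local_max_on \<Omega> (\<lambda>y. u y - \<phi> y) x \<longrightarrow>
        u x - g x \<le> 0 \<and> - lambdaD Dirs (H x) \<le> 0)"

definition visc_supersolution :: "(real^'n) set \<Rightarrow> (real^'n \<Rightarrow> real) \<Rightarrow> (real^'n) set \<Rightarrow> (real^'n \<Rightarrow> real) \<Rightarrow> bool" where
  "visc_supersolution Dirs g \<Omega> v \<longleftrightarrow> lsc_on \<Omega> v \<and>
     (\<forall>\<phi> D\<phi> H x. C2_with_hessian \<phi> D\<phi> H \<longrightarrow> x \<in> \<Omega> \<longrightarrow> local_min_on \<Omega> (\<lambda>y. v y - \<phi> y) x \<longrightarrow>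
        v x - g x \<ge> 0 \<or> - lambdaD Dirs (H x) \<ge> 0)"

end

theory Submission
  imports Defs
begin

text \<open>
  A subsolution is convex along every direction of \<open>Dirs\<close>, and an upper semicontinuous function that
  is midpoint convex along a spanning set of directions is continuous. Convexity along directions
  survives convolution, so a subsolution is a locally uniform limit of smooth functions whose
  Hessians are nonnegative on \<open>Dirs\<close>. These, after mixing in a small multiple of a paraboloid lying
  below the obstacle and below \<open>v\<close>, can be used directly as test functions touching \<open>v\<close> from below at
  an interior point. There the smallest directional curvature is positive, so \<open>v\<close> lies above the
  obstacle, whereas the perturbed subsolution lies strictly below it. No doubling of
  variables is needed.
\<close>

subsection \<open>Semicontinuous functions\<close>

text \<open>The curvature constraint asks for nonnegative second differences along each direction
  separately. This condition is linear, so averages of translates inherit it; the obstacle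
  inequality has no such stability and is therefore never imposed on the smooth approximants, but
  used for the unsmoothed function at the contact point. Two obstacles shape the rest. Convolution
  requires integrability and uniform approximation requires continuity, whereas \<open>u\<close> is
  only assumed upper semicontinuous; this is why continuity is extracted from convexity along the
  directions. Moreover, the approximation is available only on compact subsets of \<Omega>, so the
  contact point must be kept away from the frontier: the set where the perturbed subsolution exceeds
  \<open>v\<close> by at least a fixed positive amount is compact and misses the frontier, and the
  approximation error is small compared with that amount.\<close>

lemma usc_onE:
  assumes "usc_on S f" "x \<in> S" "e > 0"
  obtains d where "d > 0" "\<And>y. y \<in> S \<Longrightarrow> dist y x < d \<Longrightarrow> f y < f x + e"
  using assms unfolding usc_on_def by blast

lemma usc_on_subset: "usc_on S f \<Longrightarrow> T \<subseteq> S \<Longrightarrow> usc_on T f"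
  unfolding usc_on_def by (meson subsetD)

lemma usc_on_uminus_iff: "usc_on S (\<lambda>x. - f x) \<longleftrightarrow> lsc_on S f"
proof -
  have "- b < - a + e \<longleftrightarrow> a - e < b" for a b e :: real
    by linarith
  then show ?thesis
    unfolding usc_on_def lsc_on_def by simp
qed

lemma continuous_on_imp_usc_on:
  assumes "continuous_on S f"
  shows "usc_on S f"
  unfolding usc_on_def
proof (intro ballI allI impI)
  fix x and e :: real
  assume "x \<in> S" "0 < e"
  then obtain d where d: "d > 0" "\<And>y. y \<in> S \<Longrightarrow> dist y x < d \<Longrightarrow> dist (f y) (f x) < e"
    using assms unfolding continuous_on_iff by blast
  then have "f y < f x + e" if "y \<in> S" "dist y x < d" for y
    using d(2)[OF that] by (simp add: dist_real_def)
  with d(1) show "\<exists>d>0. \<forall>y\<in>S. dist y x < d \<longrightarrow> f y < f x + e"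
    by blast
qed

lemma usc_on_add:
  assumes "usc_on S f" "usc_on S g"
  shows "usc_on S (\<lambda>x. f x + g x)"
  unfolding usc_on_def
proof (intro ballI allI impI)
  fix x and e :: real
  assume x: "x \<in> S" and "0 < e"
  then have e: "e / 2 > 0" by simp
  obtain d1 where d1: "d1 > 0" "\<And>y. y \<in> S \<Longrightarrow> dist y x < d1 \<Longrightarrow> f y < f x + e / 2"
    using usc_onE[OF assms(1) x e] by metis
  obtain d2 where d2: "d2 > 0" "\<And>y. y \<in> S \<Longrightarrow> dist y x < d2 \<Longrightarrow> g y < g x + e / 2"
    using usc_onE[OF assms(2) x e] by metis
  have "f y + g y < f x + g x + e" if "y \<in> S" "dist y x < min d1 d2" for y
    using d1(2)[OF that(1)] d2(2)[OF that(1)] that(2) by auto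
  with d1(1) d2(1) show "\<exists>d>0. \<forall>y\<in>S. dist y x < d \<longrightarrow> f y + g y < f x + g x + e"
    by (metis min_less_iff_conj)
qed

lemma usc_on_cmult:
  assumes "usc_on S f" "c > 0"
  shows "usc_on S (\<lambda>x. c * f x)"
  unfolding usc_on_def
proof (intro ballI allI impI)
  fix x and e :: real
  assume x: "x \<in> S" and "0 < e"
  then have e: "e / c > 0" using assms(2) by simp
  obtain d where d: "d > 0" "\<And>y. y \<in> S \<Longrightarrow> dist y x < d \<Longrightarrow> f y < f x + e / c"
    using usc_onE[OF assms(1) x e] by metis
  have "c * f y < c * f x + e" if "y \<in> S" "dist y x < d" for y
    using d(2)[OF that] assms(2) by (simp add: field_simps)
  with d(1) show "\<exists>d>0. \<forall>y\<in>S. dist y x < d \<longrightarrow> c * f y < c * f x + e"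
    by blast
qed

text \<open>Without a maximiser every point has a strictly better companion \<open>h x\<close>, and
  semicontinuity keeps \<open>f\<close> below the companion's value on a ball. Finitely many balls
  cover \<open>K\<close>; the best of their companions lies in one of them and is beaten by that
  ball's companion.\<close>

lemma usc_on_attains_max:
  assumes "usc_on K f" "compact K" "K \<noteq> {}"
  shows "\<exists>x\<in>K. \<forall>y\<in>K. f y \<le> f x"
proof (rule ccontr)
  assume "\<not> ?thesis"
  then have "\<forall>x\<in>K. \<exists>y\<in>K. f x < f y"
    by (meson not_le)
  then obtain h where h: "\<And>x. x \<in> K \<Longrightarrow> h x \<in> K \<and> f x < f (h x)"
    by metis
  have "\<forall>x\<in>K. \<exists>d>0. \<forall>y\<in>K. dist y x < d \<longrightarrow> f y < f x + (f (h x) - f x)"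
    using assms(1) h unfolding usc_on_def by (meson diff_gt_0_iff_gt)
  then obtain d where d: "\<And>x. x \<in> K \<Longrightarrow> d x > 0"
      "\<And>x y. x \<in> K \<Longrightarrow> y \<in> K \<Longrightarrow> dist y x < d x \<Longrightarrow> f y < f (h x)"
    by (metis add_diff_cancel_left' diff_add_cancel)
  have "K \<subseteq> (\<Union>x\<in>K. ball x (d x))"
    using d(1) by fastforce
  then obtain C where C: "C \<subseteq> K" "finite C" "K \<subseteq> (\<Union>x\<in>C. ball x (d x))"
    using compactE_image[OF assms(2), of K "\<lambda>x. ball x (d x)"] by auto
  have "C \<noteq> {}"
    using C(3) assms(3) by auto
  define m where "m = Max ((\<lambda>x. f (h x)) ` C)"
  have "m \<in> (\<lambda>x. f (h x)) ` C"
    unfolding m_def using C \<open>C \<noteq> {}\<close> by (intro Max_in) auto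
  then obtain c where c: "c \<in> C" "m = f (h c)"
    by auto
  have "h c \<in> K"
    using c C h by auto
  then obtain x where x: "x \<in> C" "dist x (h c) < d x"
    using C(3) by auto
  then have "f (h c) < f (h x)"
    using d(2) C(1) \<open>h c \<in> K\<close> by (metis dist_commute subsetD)
  moreover have "f (h x) \<le> m"
    unfolding m_def using C x by (intro Max_ge) auto
  ultimately show False
    using c by simp
qed

lemma lsc_on_attains_min:
  assumes "lsc_on K f" "compact K" "K \<noteq> {}"
  shows "\<exists>x\<in>K. \<forall>y\<in>K. f x \<le> f y"
  using usc_on_attains_max[of K "\<lambda>x. - f x"] assms by (auto simp: usc_on_uminus_iff)

lemma usc_on_compact_superlevel:
  assumes "usc_on K f" "compact K"
  shows "compact {x\<in>K. c \<le> f x}"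
proof -
  define T where "T = \<Union>{B. open B \<and> (\<forall>y\<in>B \<inter> K. f y < c)}"
  have "x \<in> T" if x: "x \<in> K" "f x < c" for x
  proof -
    have "c - f x > 0"
      using x by simp
    then obtain d where d: "d > 0" "\<And>y. y \<in> K \<Longrightarrow> dist y x < d \<Longrightarrow> f y < f x + (c - f x)"
      using usc_onE[OF assms(1) x(1)] by metis
    then have "\<forall>y\<in>ball x d \<inter> K. f y < c"
      by (simp add: dist_commute)
    then have "ball x d \<subseteq> T"
      unfolding T_def by blast
    then show ?thesis
      using d(1) by auto
  qed
  moreover have "f x < c" if "x \<in> K" "x \<in> T" for x
    using that unfolding T_def by blast
  ultimately have "{x\<in>K. c \<le> f x} = K - T"
    by (auto simp: not_less[symmetric])
  moreover have "open T"
    unfolding T_def by blast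
  ultimately show ?thesis
    using assms(2) by (simp add: compact_diff)
qed

text \<open>The closed neighbourhood is the Minkowski sum of \<open>K\<close> and a closed ball,
  hence compact.\<close>

lemma compact_neighbourhood_in_open:
  fixes K :: "'a::euclidean_space set"
  assumes "compact K" "open U" "K \<subseteq> U"
  obtains e where "e > 0" "compact (\<Union>x\<in>K. cball x e)" "(\<Union>x\<in>K. cball x e) \<subseteq> U"
proof -
  obtain e where e: "e > 0" "(\<Union>x\<in>K. cball x e) \<subseteq> U"
    using compact_subset_open_imp_cball_epsilon_subset[OF assms] by blast
  have "(\<Union>x\<in>K. cball x e) = {x + y | x y. x \<in> K \<and> y \<in> cball 0 e}"
  proof (intro equalityI subsetI)
    fix z assume "z \<in> (\<Union>x\<in>K. cball x e)"
    then obtain x where "x \<in> K" "dist x z \<le> e" by auto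
    then have "z = x + (z - x)" "z - x \<in> cball 0 e"
      by (auto simp: dist_norm norm_minus_commute)
    then show "z \<in> {x + y | x y. x \<in> K \<and> y \<in> cball 0 e}"
      using \<open>x \<in> K\<close> by blast
  next
    fix z assume "z \<in> {x + y | x y. x \<in> K \<and> y \<in> cball 0 e}"
    then obtain x y where "x \<in> K" "norm y \<le> e" "z = x + y" by auto
    then show "z \<in> (\<Union>x\<in>K. cball x e)"
      by (intro UN_I[of x]) (auto simp: dist_norm)
  qed
  then have "compact (\<Union>x\<in>K. cball x e)"
    using compact_sums[OF assms(1) compact_cball[of 0 e]] by simp
  with e that show thesis by blast
qed

subsection \<open>Functions of class C2\<close>

text \<open>The columns of the Hessian are the values of \<open>L x\<close> at the unit vectors, so
  continuity in \<open>x\<close> for each fixed \<open>h\<close> is enough.\<close>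

lemma C2_with_hessianI:
  fixes \<phi> :: "real^'n \<Rightarrow> real"
  assumes "\<And>x. (\<phi> has_derivative (\<lambda>h. D x \<bullet> h)) (at x)"
    and "\<And>x. (D has_derivative L x) (at x)"
    and "\<And>h. continuous_on UNIV (\<lambda>x. L x h)"
  shows "C2_with_hessian \<phi> D (\<lambda>x. matrix (L x))"
proof -
  have "linear (L x)" for x
    using assms(2) has_derivative_linear by blast
  then have "(\<lambda>h. matrix (L x) *v h) = L x" for x
    by (simp add: matrix_works)
  moreover have "continuous_on UNIV (\<lambda>x. matrix (L x))"
    unfolding matrix_def using assms(3)
    by (intro continuous_on_vec_lambda continuous_on_component) auto
  ultimately show ?thesis
    unfolding C2_with_hessian_def using assms by simp
qed

lemma C2_with_hessian_add:
  assumes "C2_with_hessian \<phi> D H" "C2_with_hessian \<psi> E G"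
  shows "C2_with_hessian (\<lambda>x. \<phi> x + \<psi> x) (\<lambda>x. D x + E x) (\<lambda>x. H x + G x)"
proof -
  have "(\<bullet>) (D x + E x) = (\<lambda>h. D x \<bullet> h + E x \<bullet> h)"
      "(*v) (H x + G x) = (\<lambda>h. H x *v h + G x *v h)" for x
    by (auto simp: inner_add_left matrix_vector_mult_add_rdistrib)
  then show ?thesis
    using assms unfolding C2_with_hessian_def
    by (auto intro!: continuous_intros has_derivative_add)
qed

lemma C2_with_hessian_cmult:
  assumes "C2_with_hessian \<phi> D H"
  shows "C2_with_hessian (\<lambda>x. c * \<phi> x) (\<lambda>x. c *\<^sub>R D x) (\<lambda>x. c *\<^sub>R H x)"
proof -
  have "(\<bullet>) (c *\<^sub>R D x) = (\<lambda>h. c * (D x \<bullet> h))"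
      "(*v) (c *\<^sub>R H x) = (\<lambda>h. c *\<^sub>R (H x *v h))" for x
    by (auto simp: scaleR_matrix_vector_assoc)
  then show ?thesis
    using assms unfolding C2_with_hessian_def
    by (auto intro!: continuous_intros has_derivative_mult_right has_derivative_scaleR_right)
qed

text \<open>Serves as a test function that is affine minus a parabola along one direction and steep
  across it: \<open>N\<close> weighs all directions equally, and \<open>k\<close> can be taken large
  enough to outweigh it along \<open>a\<close>.\<close>

lemma C2_with_hessian_quadratic:
  fixes a p :: "real^'n"
  shows "C2_with_hessian
     (\<lambda>y. b * (a \<bullet> (y - p)) - k * (a \<bullet> (y - p))\<^sup>2 + N * ((y - p) \<bullet> (y - p)))
     (\<lambda>y. b *\<^sub>R a - (2 * k * (a \<bullet> (y - p))) *\<^sub>R a + (2 * N) *\<^sub>R (y - p))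
     (\<lambda>y. matrix (\<lambda>h. (2 * N) *\<^sub>R h - (2 * k * (a \<bullet> h)) *\<^sub>R a))"
proof (rule C2_with_hessianI)
  fix x :: "real^'n"
  show "((\<lambda>y. b * (a \<bullet> (y - p)) - k * (a \<bullet> (y - p))\<^sup>2 + N * ((y - p) \<bullet> (y - p)))
      has_derivative
      (\<lambda>h. (b *\<^sub>R a - (2 * k * (a \<bullet> (x - p))) *\<^sub>R a + (2 * N) *\<^sub>R (x - p)) \<bullet> h)) (at x)"
    by (rule derivative_eq_intros refl)+
      (simp add: fun_eq_iff inner_simps inner_commute algebra_simps)
  show "((\<lambda>y. b *\<^sub>R a - (2 * k * (a \<bullet> (y - p))) *\<^sub>R a + (2 * N) *\<^sub>R (y - p))
      has_derivative (\<lambda>h. (2 * N) *\<^sub>R h - (2 * k * (a \<bullet> h)) *\<^sub>R a)) (at x)"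
    by (rule derivative_eq_intros refl)+ (simp add: fun_eq_iff algebra_simps)
qed (intro continuous_intros)

lemma quadratic_hessian_apply:
  fixes a h :: "real^'n"
  shows "matrix (\<lambda>h. (2 * N) *\<^sub>R h - (2 * k * (a \<bullet> h)) *\<^sub>R a) *v h
     = (2 * N) *\<^sub>R h - (2 * k * (a \<bullet> h)) *\<^sub>R a"
proof -
  have "linear (\<lambda>h. (2 * N) *\<^sub>R h - (2 * k * (a \<bullet> h)) *\<^sub>R a)"
    by (rule linearI) (simp_all add: algebra_simps inner_simps)
  from fun_cong[OF matrix_vector_mul(2)[OF this]] show ?thesis .
qed

lemma C2_with_hessian_paraboloid:
  fixes p :: "real^'n"
  shows "C2_with_hessian (\<lambda>y. N * ((y - p) \<bullet> (y - p))) (\<lambda>y. (2 * N) *\<^sub>R (y - p)) (\<lambda>_. (2 * N) *\<^sub>R mat 1)"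
proof -
  have "(*v) ((2 * N) *\<^sub>R mat 1 :: real^'n^'n) = (\<lambda>h. (2 * N) *\<^sub>R h)"
    by (simp add: fun_eq_iff scaleR_matrix_vector_assoc[symmetric])
  then show ?thesis
    unfolding C2_with_hessian_def
    by (auto intro!: derivative_eq_intros simp: fun_eq_iff inner_commute)
qed

text \<open>An infimum of reals is a lower bound only if the set is bounded below; Cauchy-Schwarz
  and the operator norm of \<open>M\<close> provide such a bound.\<close>

lemma lambdaD_le:
  assumes "d \<in> Dirs"
  shows "lambdaD Dirs M \<le> (d \<bullet> (M *v d)) / (norm d)\<^sup>2"
  unfolding lambdaD_def
proof (rule cINF_lower[OF bdd_belowI2 assms])
  fix v assume "v \<in> Dirs"
  have "\<bar>v \<bullet> (M *v v)\<bar> \<le> norm v * norm (M *v v)"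
    by (rule Cauchy_Schwarz_ineq2)
  also have "\<dots> \<le> norm v * (onorm ((*v) M) * norm v)"
    by (intro mult_left_mono onorm matrix_vector_mul_bounded_linear) auto
  finally have "- (onorm ((*v) M) * (norm v)\<^sup>2) \<le> v \<bullet> (M *v v)"
    by (simp add: power2_eq_square algebra_simps)
  then show "- onorm ((*v) M) \<le> (v \<bullet> (M *v v)) / (norm v)\<^sup>2"
    by (cases "v = 0")
      (auto simp: field_simps intro: onorm_pos_le matrix_vector_mul_bounded_linear)
qed

lemma lambdaD_ge:
  assumes "Dirs \<noteq> {}" "0 \<notin> Dirs" "\<And>d. d \<in> Dirs \<Longrightarrow> c * (norm d)\<^sup>2 \<le> d \<bullet> (M *v d)"
  shows "c \<le> lambdaD Dirs M"
  unfolding lambdaD_def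
proof (rule cINF_greatest[OF assms(1)])
  fix d assume "d \<in> Dirs"
  then show "c \<le> (d \<bullet> (M *v d)) / (norm d)\<^sup>2"
    using assms(2) assms(3)[of d] by (subst pos_le_divide_eq) auto
qed

subsection \<open>Subsolutions are convex along the directions\<close>

text \<open>Convexity local to \<Omega>: the entire segment must lie in \<Omega>, which need not be
  convex. Since \<open>s\<close> is an arbitrary real, only the line spanned by \<open>d\<close>
  matters. Midpoints are enough because the continuity argument and the sign of the Hessian use only
  second differences.\<close>

definition midpoint_convex_along :: "(real^'n) set \<Rightarrow> (real^'n) set \<Rightarrow> (real^'n \<Rightarrow> real) \<Rightarrow> bool" where
  "midpoint_convex_along Dirs \<Omega> u \<longleftrightarrow>
     (\<forall>x. \<forall>d\<in>Dirs. \<forall>s. (\<forall>t. \<bar>t\<bar> \<le> \<bar>s\<bar> \<longrightarrow> x + t *\<^sub>R d \<in> \<Omega>) \<longrightarrow>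
        2 * u x \<le> u (x + s *\<^sub>R d) + u (x - s *\<^sub>R d))"

text \<open>The test function is affine minus a small parabola along \<open>d\<close> and grows like \<open>N\<close> times
  the squared distance transversally. It touches \<open>u\<close> from above inside a thin tube around the
  segment as soon as midpoint convexity fails on it.\<close>

lemma visc_subsolution_midpoint_convex:
  fixes \<Omega> Dirs :: "(real^'n) set"
  assumes sub: "visc_subsolution Dirs g \<Omega> u" and "open \<Omega>" and "0 \<notin> Dirs"
  shows "midpoint_convex_along Dirs \<Omega> u"
  unfolding midpoint_convex_along_def
proof (intro allI ballI impI)
  fix x d :: "real^'n" and s0 :: real
  assume d: "d \<in> Dirs" and seg0: "\<forall>t. \<bar>t\<bar> \<le> \<bar>s0\<bar> \<longrightarrow> x + t *\<^sub>R d \<in> \<Omega>"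
  define s where "s = \<bar>s0\<bar>"
  have seg: "x + t *\<^sub>R d \<in> \<Omega>" if "\<bar>t\<bar> \<le> s" for t
    using seg0 that by (simp add: s_def)
  have usc: "usc_on \<Omega> u"
    using sub by (simp add: visc_subsolution_def)
  have "d \<noteq> 0"
    using d assms(3) by auto
  have "2 * u x \<le> u (x + s *\<^sub>R d) + u (x - s *\<^sub>R d)"
  proof (rule ccontr)
    assume fails: "\<not> ?thesis"
    define p m where "p = x + s *\<^sub>R d" and "m = x - s *\<^sub>R d"
    define D where "D = u x - (u p + u m) / 2"
    have D: "D > 0"
      using fails by (simp add: D_def p_def m_def field_simps)
    then have "s \<noteq> 0"
      by (auto simp: D_def p_def m_def)
    then have s: "s > 0"
      by (simp add: s_def)
    have pm: "p \<in> \<Omega>" "m \<in> \<Omega>"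
      using seg[of s] seg[of "- s"] s by (auto simp: p_def m_def)
    \<comment> \<open>\<open>\<beta>\<close> is the slope of the chord, and \<open>\<eta>\<close>
      bends the parabola by half the defect \<open>D\<close> at the ends. Together with the margin
      \<open>D / 4\<close> from upper semicontinuity there, this leaves a gap of
      \<open>D / 4\<close> on both caps of the tube.\<close>
    define \<beta> where "\<beta> = (u p - u m) / (2 * s)"
    define \<eta> where "\<eta> = D / (2 * s\<^sup>2)"
    have \<eta>: "\<eta> > 0"
      using D s by (simp add: \<eta>_def)
    have \<eta>s: "\<eta> * s\<^sup>2 = D / 2" and \<beta>s: "\<beta> * s = (u p - u m) / 2"
      using s by (auto simp: \<eta>_def \<beta>_def)
    \<comment> \<open>\<open>a\<close> is dual to \<open>d\<close>: \<open>\<tau>\<close> is the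
      coordinate along \<open>d\<close> and \<open>\<nu>\<close> the component orthogonal to
      \<open>d\<close>.\<close>
    define a where "a = d /\<^sub>R (d \<bullet> d)"
    define \<tau> where "\<tau> y = a \<bullet> (y - x)" for y
    define \<nu> where "\<nu> y = y - x - \<tau> y *\<^sub>R d" for y
    have dd: "d \<bullet> d > 0"
      using \<open>d \<noteq> 0\<close> by simp
    have ad: "a \<bullet> d = 1"
      using dd by (simp add: a_def)
    have cont: "continuous_on UNIV \<tau>" "continuous_on UNIV (\<lambda>y. norm (\<nu> y))"
      unfolding \<nu>_def \<tau>_def by (intro continuous_intros)+
    have decomp: "y = x + \<tau> y *\<^sub>R d + \<nu> y" for y
      by (simp add: \<nu>_def)

    have "compact ((\<lambda>t. x + t *\<^sub>R d) ` {-s..s})"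
      by (intro compact_continuous_image continuous_intros) auto
    moreover have "(\<lambda>t. x + t *\<^sub>R d) ` {-s..s} \<subseteq> \<Omega>"
      using seg by (auto simp: abs_le_iff)
    ultimately obtain r0 where r0: "r0 > 0" "(\<Union>z\<in>(\<lambda>t. x + t *\<^sub>R d) ` {-s..s}. cball z r0) \<subseteq> \<Omega>"
      using compact_subset_open_imp_cball_epsilon_subset \<open>open \<Omega>\<close> by metis
    have "D / 4 > 0" using D by simp
    obtain d1 where d1: "d1 > 0" "\<And>y. y \<in> \<Omega> \<Longrightarrow> dist y p < d1 \<Longrightarrow> u y < u p + D / 4"
      using usc_onE[OF usc pm(1) \<open>D / 4 > 0\<close>] by metis
    obtain d2 where d2: "d2 > 0" "\<And>y. y \<in> \<Omega> \<Longrightarrow> dist y m < d2 \<Longrightarrow> u y < u m + D / 4"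
      using usc_onE[OF usc pm(2) \<open>D / 4 > 0\<close>] by metis
    define r where "r = min r0 (min d1 d2) / 2"
    have r: "r > 0" "r \<le> r0" "r < d1" "r < d2"
      using r0 d1(1) d2(1) by (auto simp: r_def)

    define T where "T = {y. \<bar>\<tau> y\<bar> \<le> s \<and> norm (\<nu> y) \<le> r}"
    have T\<Omega>: "T \<subseteq> \<Omega>"
    proof
      fix y assume "y \<in> T"
      then have "\<tau> y \<in> {-s..s}" "norm (\<nu> y) \<le> r0"
        using r by (auto simp: T_def)
      moreover have "dist (x + \<tau> y *\<^sub>R d) y = norm (\<nu> y)"
        by (simp add: \<nu>_def dist_norm norm_minus_commute algebra_simps)
      ultimately have "y \<in> cball (x + \<tau> y *\<^sub>R d) r0"
        by simp
      then show "y \<in> \<Omega>"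
        using r0(2) \<open>\<tau> y \<in> {-s..s}\<close> by blast
    qed
    have "bounded T"
    proof (rule boundedI)
      fix y assume y: "y \<in> T"
      have "norm y \<le> norm x + norm (\<tau> y *\<^sub>R d) + norm (\<nu> y)"
        using decomp[of y] by (metis norm_triangle_le norm_triangle_ineq add_mono order_refl)
      also have "\<dots> \<le> norm x + s * norm d + r"
        using y by (auto simp: T_def intro!: add_mono mult_right_mono)
      finally show "norm y \<le> norm x + s * norm d + r" .
    qed
    moreover have "closed T"
      unfolding T_def
      by (intro closed_Collect_conj closed_Collect_le continuous_intros cont)
    ultimately have T: "compact T"
      by (simp add: compact_eq_bounded_closed)
    have xT: "x \<in> T"
      using r s by (simp add: T_def \<tau>_def \<nu>_def)
    obtain y0 where y0: "\<And>y. y \<in> T \<Longrightarrow> u y \<le> u y0"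
      using usc_on_attains_max[OF usc_on_subset[OF usc T\<Omega>] T] xT by blast
    \<comment> \<open>On the lateral wall, where \<open>\<nu>\<close> has norm \<open>r\<close>,
      this weight lifts \<open>\<phi>\<close> to at least \<open>u y0 - u x + 1\<close> whatever the
      terms in \<open>\<tau>\<close> contribute, so \<open>u - \<phi>\<close> falls below its value
      at the centre.\<close>
    define N where "N = (u y0 + \<bar>\<beta>\<bar> * s + \<eta> * s\<^sup>2 - u x + 1) / r\<^sup>2"
    have "\<bar>\<beta>\<bar> * s \<ge> 0" "\<eta> * s\<^sup>2 \<ge> 0"
      using s \<eta> by auto
    then have N: "N \<ge> 0" "N * r\<^sup>2 = u y0 + \<bar>\<beta>\<bar> * s + \<eta> * s\<^sup>2 - u x + 1"
      using y0[OF xT] r by (auto simp: N_def intro!: divide_nonneg_nonneg)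

    \<comment> \<open>The extra coefficient \<open>N * (d \<bullet> d)\<close> removes the part of
      the paraboloid along \<open>d\<close>, leaving \<open>N\<close> times the squared norm of
      \<open>\<nu>\<close>.\<close>
    define \<phi> where "\<phi> y = \<beta> * (a \<bullet> (y - x)) - (\<eta> + N * (d \<bullet> d)) * (a \<bullet> (y - x))\<^sup>2
        + N * ((y - x) \<bullet> (y - x))" for y
    have \<phi>: "\<phi> y = \<beta> * \<tau> y - \<eta> * (\<tau> y)\<^sup>2 + N * (norm (\<nu> y))\<^sup>2" for y
    proof -
      have "d \<bullet> (y - x) = \<tau> y * (d \<bullet> d)"
        using dd by (simp add: \<tau>_def a_def)
      then have "(norm (\<nu> y))\<^sup>2 = (y - x) \<bullet> (y - x) - (\<tau> y)\<^sup>2 * (d \<bullet> d)"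
        unfolding \<nu>_def power2_norm_eq_inner
        by (simp add: inner_diff_left inner_diff_right inner_commute power2_eq_square algebra_simps)
      then have "(y - x) \<bullet> (y - x) = (norm (\<nu> y))\<^sup>2 + (\<tau> y)\<^sup>2 * (d \<bullet> d)"
        by simp
      then show ?thesis
        unfolding \<phi>_def \<tau>_def[symmetric] by (simp only:) (simp add: algebra_simps)
    qed
    have "continuous_on T (\<lambda>y. - \<phi> y)"
      unfolding \<phi>_def by (intro continuous_intros)
    then have "usc_on T (\<lambda>y. u y + - \<phi> y)"
      by (intro usc_on_add usc_on_subset[OF usc T\<Omega>] continuous_on_imp_usc_on)
    then obtain y where y: "y \<in> T" "\<And>z. z \<in> T \<Longrightarrow> u z - \<phi> z \<le> u y - \<phi> y"
      using usc_on_attains_max[OF _ T] xT by fastforce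
    have "\<phi> x = 0"
      by (simp add: \<phi>_def)
    then have ge: "u x \<le> u y - \<phi> y"
      using y(2)[OF xT] by simp
    have y\<Omega>: "y \<in> \<Omega>"
      using y(1) T\<Omega> by blast
    have Nn: "N * (norm (\<nu> y))\<^sup>2 \<ge> 0"
      using N(1) by simp

    \<comment> \<open>The maximiser over the tube lies neither on the wall nor on a cap, so it is a
      local maximum relative to \<Omega>.\<close>
    have "norm (\<nu> y) \<noteq> r"
    proof
      assume eq: "norm (\<nu> y) = r"
      have "\<bar>\<beta> * \<tau> y\<bar> \<le> \<bar>\<beta>\<bar> * s"
        unfolding abs_mult using y(1) by (intro mult_left_mono) (auto simp: T_def)
      moreover have "\<eta> * (\<tau> y)\<^sup>2 \<le> \<eta> * s\<^sup>2"
        using y(1) \<eta> s by (intro mult_left_mono) (auto simp: T_def abs_le_square_iff[symmetric])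
      ultimately have "\<phi> y \<ge> u y0 - u x + 1"
        unfolding \<phi> eq N(2) by linarith
      then show False
        using ge y0[OF y(1)] by linarith
    qed
    moreover have "\<tau> y \<noteq> s"
    proof
      assume eq: "\<tau> y = s"
      have "dist y p = norm (\<nu> y)"
        by (simp add: dist_norm p_def \<nu>_def eq algebra_simps)
      then have "u y < u p + D / 4"
        using d1(2)[OF y\<Omega>] y(1) r by (simp add: T_def)
      moreover have "\<phi> y \<ge> (u p - u m) / 2 - D / 2"
        unfolding \<phi> eq \<eta>s \<beta>s using Nn by linarith
      moreover have "D = u x - u p / 2 - u m / 2" "u p - u m = 2 * (u p / 2 - u m / 2)"
        by (simp_all add: D_def field_simps)
      ultimately show False
        using ge D by argo
    qed
    moreover have "\<tau> y \<noteq> - s"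
    proof
      assume eq: "\<tau> y = - s"
      have "dist y m = norm (\<nu> y)"
        by (simp add: dist_norm m_def \<nu>_def eq algebra_simps)
      then have "u y < u m + D / 4"
        using d2(2)[OF y\<Omega>] y(1) r by (simp add: T_def)
      moreover have "\<phi> y \<ge> - ((u p - u m) / 2) - D / 2"
        unfolding \<phi> eq power2_minus mult_minus_right \<eta>s \<beta>s using Nn by linarith
      moreover have "D = u x - u p / 2 - u m / 2" "u p - u m = 2 * (u p / 2 - u m / 2)"
        by (simp_all add: D_def field_simps)
      ultimately show False
        using ge D by argo
    qed
    ultimately have yint: "\<bar>\<tau> y\<bar> < s" "norm (\<nu> y) < r"
      using y(1) by (auto simp: T_def)
    have "open {z. \<bar>\<tau> z\<bar> < s \<and> norm (\<nu> z) < r}"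
      by (intro open_Collect_conj open_Collect_less continuous_intros cont)
    then obtain e where e: "e > 0" "ball y e \<subseteq> {z. \<bar>\<tau> z\<bar> < s \<and> norm (\<nu> z) < r}"
      using yint unfolding open_contains_ball by blast
    have "u z - \<phi> z \<le> u y - \<phi> y" if "dist z y < e" for z
    proof (rule y(2))
      have "z \<in> ball y e"
        using that by (simp add: dist_commute)
      then show "z \<in> T"
        using e(2) unfolding T_def by fastforce
    qed
    then have "local_max_on \<Omega> (\<lambda>z. u z - \<phi> z) y"
      unfolding local_max_on_def using e(1) by blast
    moreover note C2_with_hessian_quadratic[of \<beta> a x "\<eta> + N * (d \<bullet> d)" N, folded \<phi>_def]
    ultimately have "- lambdaD Dirs (matrix (\<lambda>h. (2 * N) *\<^sub>R h - (2 * (\<eta> + N * (d \<bullet> d)) * (a \<bullet> h)) *\<^sub>R a)) \<le> 0"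
      using sub y\<Omega> unfolding visc_subsolution_def by blast
    then have "0 \<le> (d \<bullet> ((2 * N) *\<^sub>R d - (2 * (\<eta> + N * (d \<bullet> d)) * (a \<bullet> d)) *\<^sub>R a)) / (norm d)\<^sup>2"
      using lambdaD_le[OF d, of "matrix (\<lambda>h. (2 * N) *\<^sub>R h - (2 * (\<eta> + N * (d \<bullet> d)) * (a \<bullet> h)) *\<^sub>R a)",
          unfolded quadratic_hessian_apply] by linarith
    \<comment> \<open>The weight \<open>N\<close> cancels along \<open>d\<close>, however steep the
      wall had to be; only the concavity from \<open>\<eta>\<close> survives.\<close>
    also have "d \<bullet> ((2 * N) *\<^sub>R d - (2 * (\<eta> + N * (d \<bullet> d)) * (a \<bullet> d)) *\<^sub>R a) = - 2 * \<eta>"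
      using ad by (simp add: inner_diff_right inner_commute algebra_simps)
    finally have "0 \<le> (- 2 * \<eta>) / (norm d)\<^sup>2" .
    moreover have "(- 2 * \<eta>) / (norm d)\<^sup>2 < 0"
      using \<eta> \<open>d \<noteq> 0\<close> by (intro divide_neg_pos) auto
    ultimately show False
      by linarith
  qed
  then show "2 * u x \<le> u (x + s0 *\<^sub>R d) + u (x - s0 *\<^sub>R d)"
    by (cases "s0 \<ge> 0") (auto simp: s_def)
qed

text \<open>The definition yields the inequality only at points touched from above by a test
  function, and \<open>x\<close> itself need not be one. A steep paraboloid centred at
  \<open>x\<close> forces a touching point \<open>y\<close> within \<open>r\<close> of
  \<open>x\<close>, where \<open>g\<close> has changed by less than \<open>e\<close>, and
  \<open>u x \<le> u y\<close> up to a nonnegative term of the right sign.\<close>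

lemma visc_subsolution_le_obstacle:
  fixes \<Omega> :: "(real^'n) set"
  assumes sub: "visc_subsolution Dirs g \<Omega> u" and "open \<Omega>" and g: "continuous_on UNIV g"
    and x: "x \<in> \<Omega>"
  shows "u x \<le> g x"
proof (rule field_le_epsilon)
  fix e :: real assume "e > 0"
  have usc: "usc_on \<Omega> u"
    using sub by (simp add: visc_subsolution_def)
  obtain r0 where r0: "r0 > 0" "cball x r0 \<subseteq> \<Omega>"
    using \<open>open \<Omega>\<close> x open_contains_cball by blast
  obtain r1 where r1: "r1 > 0" "\<And>y. dist y x < r1 \<Longrightarrow> dist (g y) (g x) < e"
    using g \<open>e > 0\<close> unfolding continuous_on_iff by blast
  define r where "r = min r0 r1 / 2"
  have r: "r > 0" "r < r1" "cball x r \<subseteq> \<Omega>"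
    using r0 r1(1) by (auto simp: r_def)
  have usc_r: "usc_on (cball x r) u"
    using usc_on_subset usc r(3) by blast
  have xr: "x \<in> cball x r"
    using r(1) by simp
  obtain y0 where y0: "\<And>y. y \<in> cball x r \<Longrightarrow> u y \<le> u y0"
    using usc_on_attains_max[OF usc_r compact_cball] xr by blast
  define N where "N = (u y0 - u x + 1) / r\<^sup>2"
  have N: "N \<ge> 0" "N * r\<^sup>2 = u y0 - u x + 1"
    using y0[OF xr] r by (auto simp: N_def)
  define \<phi> where "\<phi> y = N * ((y - x) \<bullet> (y - x))" for y
  have \<phi>: "\<phi> y = N * (dist x y)\<^sup>2" for y
    by (simp add: \<phi>_def dist_norm norm_minus_commute[of x] power2_norm_eq_inner)
  have "continuous_on (cball x r) (\<lambda>y. - \<phi> y)"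
    unfolding \<phi>_def by (intro continuous_intros)
  then have "usc_on (cball x r) (\<lambda>y. u y + - \<phi> y)"
    by (intro usc_on_add usc_r continuous_on_imp_usc_on)
  then obtain y where y: "y \<in> cball x r" "\<And>z. z \<in> cball x r \<Longrightarrow> u z - \<phi> z \<le> u y - \<phi> y"
    using usc_on_attains_max[of "cball x r" "\<lambda>y. u y + - \<phi> y"] xr by fastforce
  have ge: "u x \<le> u y - \<phi> y"
    using y(2)[OF xr] by (simp add: \<phi>)
  have "dist x y \<noteq> r"
    using ge y0[OF y(1)] N(2) unfolding \<phi> by auto
  then have "y \<in> ball x r"
    using y(1) by simp
  then obtain e' where e': "e' > 0" "ball y e' \<subseteq> ball x r"
    using open_ball open_contains_ball by blast
  have "u z - \<phi> z \<le> u y - \<phi> y" if "dist z y < e'" for z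
  proof (rule y(2))
    have "z \<in> ball y e'"
      using that by (simp add: dist_commute)
    then show "z \<in> cball x r"
      using e'(2) ball_subset_cball by blast
  qed
  then have "local_max_on \<Omega> (\<lambda>z. u z - \<phi> z) y"
    unfolding local_max_on_def using e'(1) by blast
  moreover note C2_with_hessian_paraboloid[of N x, folded \<phi>_def]
  moreover have "y \<in> \<Omega>"
    using y(1) r(3) by blast
  ultimately have "u y \<le> g y"
    using sub unfolding visc_subsolution_def by fastforce
  moreover have "\<phi> y \<ge> 0"
    using N(1) by (simp add: \<phi>)
  moreover have "g y < g x + e"
    using r1(2)[of y] y(1) r(2) by (auto simp: dist_commute dist_real_def)
  ultimately show "u x \<le> g x + e"
    using ge by linarith
qed

text \<open>Reflection turns an upper bound into a lower one: \<open>u (y + c d *\<^sub>R d) \<ge> 2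
  * u y - u (y - c d *\<^sub>R d)\<close>, where induction over the directions bounds
  \<open>u y\<close> from below and upper semicontinuity bounds the last term from above. The losses
  are \<open>e / 4\<close> twice and \<open>e / 4\<close> once, in total less than
  \<open>e\<close>.\<close>

lemma midpoint_convex_along_lower_bound:
  fixes \<Omega> B :: "(real^'n) set"
  assumes "open \<Omega>" and usc: "usc_on \<Omega> u" and mid: "midpoint_convex_along Dirs \<Omega> u"
    and x: "x \<in> \<Omega>"
    and "finite B" "B \<subseteq> Dirs" "e > 0"
  shows "\<exists>\<delta>>0. \<forall>c. (\<forall>b\<in>B. \<bar>c b\<bar> < \<delta>) \<longrightarrow> u x - e < u (x + (\<Sum>b\<in>B. c b *\<^sub>R b))"
  using assms(5-7)
proof (induction B arbitrary: e rule: finite_induct)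
  case empty
  then show ?case
    by (auto intro: exI[of _ 1])
next
  case (insert d B)
  have "e / 4 > 0"
    using insert.prems by simp
  then obtain \<delta>1 where \<delta>1: "\<delta>1 > 0"
      "\<And>c. (\<forall>b\<in>B. \<bar>c b\<bar> < \<delta>1) \<Longrightarrow> u x - e / 4 < u (x + (\<Sum>b\<in>B. c b *\<^sub>R b))"
    using insert.IH[of "e / 4"] insert.prems by blast
  obtain r0 where r0: "r0 > 0" "ball x r0 \<subseteq> \<Omega>"
    using \<open>open \<Omega>\<close> x open_contains_ball by blast
  obtain r1 where r1: "r1 > 0" "\<And>y. y \<in> \<Omega> \<Longrightarrow> dist y x < r1 \<Longrightarrow> u y < u x + e / 4"
    using usc_onE[OF usc x \<open>e / 4 > 0\<close>] by metis
  define r where "r = min r0 r1"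
  define S where "S = (\<Sum>b\<in>insert d B. norm b)"
  have "S \<ge> 0"
    unfolding S_def by (intro sum_nonneg) auto
  \<comment> \<open>The summand 1 avoids a zero denominator and makes
    \<open>\<delta> * S < r\<close> strict, which keeps the whole segment from
    \<open>y - c d *\<^sub>R d\<close> to \<open>y + c d *\<^sub>R d\<close> in the ball of radius
    \<open>r\<close>.\<close>
  define \<delta> where "\<delta> = min \<delta>1 (r / (1 + S))"
  have r: "r > 0"
    using r0 r1 by (simp add: r_def)
  have \<delta>: "\<delta> > 0" "\<delta> \<le> \<delta>1" "\<delta> * S < r"
  proof -
    show "\<delta> > 0" "\<delta> \<le> \<delta>1"
      using \<delta>1(1) r \<open>S \<ge> 0\<close> by (auto simp: \<delta>_def)
    have "\<delta> * S \<le> r / (1 + S) * S"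
      using \<open>S \<ge> 0\<close> by (intro mult_right_mono) (auto simp: \<delta>_def)
    also have "\<dots> < r"
      using r \<open>S \<ge> 0\<close> by (simp add: field_simps)
    finally show "\<delta> * S < r" .
  qed
  have "u x - e < u (x + (\<Sum>b\<in>insert d B. c b *\<^sub>R b))" if c: "\<forall>b\<in>insert d B. \<bar>c b\<bar> < \<delta>" for c
  proof -
    define y where "y = x + (\<Sum>b\<in>B. c b *\<^sub>R b)"
    have near: "dist (y + t *\<^sub>R d) x < r" if "\<bar>t\<bar> \<le> \<bar>c d\<bar>" for t
    proof -
      have "dist (y + t *\<^sub>R d) x = norm ((\<Sum>b\<in>B. c b *\<^sub>R b) + t *\<^sub>R d)"
        by (simp add: dist_norm y_def)
      also have "\<dots> \<le> (\<Sum>b\<in>B. norm (c b *\<^sub>R b)) + norm (t *\<^sub>R d)"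
        by (intro norm_triangle_le add_mono norm_sum order_refl)
      also have "\<dots> \<le> (\<Sum>b\<in>B. \<delta> * norm b) + \<delta> * norm d"
      proof (intro add_mono sum_mono)
        show "norm (c b *\<^sub>R b) \<le> \<delta> * norm b" if "b \<in> B" for b
          using c that by (simp add: mult_right_mono less_imp_le)
        have "\<bar>t\<bar> \<le> \<delta>"
          using c that by fastforce
        then show "norm (t *\<^sub>R d) \<le> \<delta> * norm d"
          by (simp add: mult_right_mono)
      qed
      also have "\<dots> = \<delta> * S"
        using insert.hyps by (simp add: S_def sum_distrib_left algebra_simps)
      finally show ?thesis
        using \<delta>(3) by linarith
    qed
    then have in\<Omega>: "y + t *\<^sub>R d \<in> \<Omega>" if "\<bar>t\<bar> \<le> \<bar>c d\<bar>" for t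
      using r0(2) that by (force simp: r_def dist_commute)
    then have "2 * u y \<le> u (y + c d *\<^sub>R d) + u (y - c d *\<^sub>R d)"
      using mid insert.prems unfolding midpoint_convex_along_def by blast
    moreover have "u (y - c d *\<^sub>R d) < u x + e / 4"
      using r1(2)[of "y + (- c d) *\<^sub>R d"] near[of "- c d"] in\<Omega>[of "- c d"] by (simp add: r_def)
    moreover have "u x - e / 4 < u y"
      unfolding y_def using c \<delta>(2) by (intro \<delta>1(2)) fastforce
    moreover have "x + (\<Sum>b\<in>insert d B. c b *\<^sub>R b) = y + c d *\<^sub>R d"
      using insert.hyps by (simp add: y_def algebra_simps)
    ultimately show ?thesis
      using insert.prems by auto
  qed
  then show ?case
    using \<delta>(1) by blast
qed

text \<open>A basis chosen among the directions gives coordinates that depend continuously on the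
  point, so near \<open>x\<close> they are small enough for the preceding lower bound; this supplies
  the missing lower semicontinuity.\<close>

lemma midpoint_convex_along_continuous:
  fixes \<Omega> Dirs :: "(real^'n) set"
  assumes "open \<Omega>" and usc: "usc_on \<Omega> u" and mid: "midpoint_convex_along Dirs \<Omega> u"
    and span: "span Dirs = UNIV"
  shows "continuous_on \<Omega> u"
proof -
  obtain B where B: "B \<subseteq> Dirs" "independent B" "Dirs \<subseteq> span B"
    using maximal_independent_subset by metis
  have fin: "finite B"
    using B(2) independent_imp_finite by blast
  have spanB: "span B = UNIV"
    using B(3) span by (metis span_mono span_span top.extremum_uniqueI)
  have lin: "linear (\<lambda>v. representation B v b)" for b
    by (rule linearI) (use B(2) spanB in \<open>auto simp: representation_add representation_scale\<close>)
  have "isCont u x" if x: "x \<in> \<Omega>" for x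
    unfolding isCont_def tendsto_iff
  proof (intro allI impI)
    fix e :: real assume "e > 0"
    obtain \<delta> where \<delta>: "\<delta> > 0"
        "\<And>c. (\<forall>b\<in>B. \<bar>c b\<bar> < \<delta>) \<Longrightarrow> u x - e < u (x + (\<Sum>b\<in>B. c b *\<^sub>R b))"
      using midpoint_convex_along_lower_bound[OF \<open>open \<Omega>\<close> usc mid x fin B(1) \<open>e > 0\<close>] by blast
    obtain r where r: "r > 0" "\<And>y. y \<in> \<Omega> \<Longrightarrow> dist y x < r \<Longrightarrow> u y < u x + e"
      using usc_onE[OF usc x \<open>e > 0\<close>] by metis
    have "\<forall>\<^sub>F y in at x. \<bar>representation B (y - x) b\<bar> < \<delta>" for b
    proof -
      have "bounded_linear (\<lambda>v. representation B v b)"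
        using lin linear_conv_bounded_linear by blast
      then have "((\<lambda>y. \<bar>representation B (y - x) b\<bar>) \<longlongrightarrow> \<bar>representation B (x - x) b\<bar>) (at x)"
        by (rule bounded_linear.tendsto[THEN tendsto_rabs]) (intro tendsto_intros)
      then show ?thesis
        using \<delta>(1) by (intro order_tendstoD(2)) (auto simp: representation_zero)
    qed
    then have "\<forall>\<^sub>F y in at x. \<forall>b\<in>B. \<bar>representation B (y - x) b\<bar> < \<delta>"
      using fin by (simp add: eventually_ball_finite)
    moreover have "\<forall>\<^sub>F y in at x. y \<in> \<Omega>"
      using \<open>open \<Omega>\<close> x by (simp add: eventually_at_in_open')
    moreover have "\<forall>\<^sub>F y in at x. dist y x < r"
      using r(1) eventually_at by blast
    ultimately show "\<forall>\<^sub>F y in at x. dist (u y) (u x) < e"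
    proof eventually_elim
      case (elim y)
      have "(\<Sum>b\<in>B. representation B (y - x) b *\<^sub>R b) = y - x"
        using B(2) fin spanB by (intro sum_representation_eq) auto
      then have "u x - e < u y"
        using \<delta>(2)[OF elim(1)] by simp
      then show ?case
        using r(2)[OF elim(2,3)] by (simp add: dist_real_def)
    qed
  qed
  then show ?thesis
    by (simp add: continuous_at_imp_continuous_on)
qed

subsection \<open>Mollification\<close>

text \<open>Only the kink at 0 needs care: the difference quotient there is at most
  \<open>\<bar>h\<bar> ^ n\<close>, which tends to 0.\<close>

lemma has_real_derivative_max_0_power:
  fixes s :: real
  assumes "n > 0"
  shows "((\<lambda>s. max 0 s ^ Suc n) has_real_derivative (real (Suc n) * max 0 s ^ n)) (at s)"
proof -
  consider "s < 0" | "s > 0" | "s = 0"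
    by linarith
  then show ?thesis
  proof cases
    case 1
    have "((\<lambda>s. 0) has_real_derivative 0) (at s)"
      by simp
    then have "((\<lambda>s. max 0 s ^ Suc n) has_real_derivative 0) (at s)"
      by (rule has_field_derivative_transform_within_open[of _ _ _ "{..<0}"]) (use 1 in auto)
    moreover have "real (Suc n) * max 0 s ^ n = 0"
      using 1 assms by (simp add: max_def)
    ultimately show ?thesis
      by (simp only:)
  next
    case 2
    have "((\<lambda>s. s ^ Suc n) has_real_derivative (real (Suc n) * s ^ n)) (at s)"
      using DERIV_pow[of "Suc n" s] by simp
    then have "((\<lambda>s. max 0 s ^ Suc n) has_real_derivative (real (Suc n) * s ^ n)) (at s)"
      by (rule has_field_derivative_transform_within_open[of _ _ _ "{0<..}"]) (use 2 in auto)
    then show ?thesis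
      using 2 by simp
  next
    case 3
    have "((\<lambda>h::real. \<bar>h\<bar> ^ n) \<longlongrightarrow> \<bar>0\<bar> ^ n) (at 0)"
      by (intro tendsto_intros)
    moreover have "\<bar>0::real\<bar> ^ n = 0"
      using assms by simp
    ultimately have lim: "((\<lambda>h::real. \<bar>h\<bar> ^ n) \<longlongrightarrow> 0) (at 0)"
      by (simp only:)
    have "((\<lambda>h::real. max 0 h ^ Suc n / h) \<longlongrightarrow> 0) (at 0)"
    proof (rule Lim_null_comparison[OF _ lim])
      have "norm (max 0 h ^ Suc n / h) \<le> \<bar>h\<bar> ^ n" for h :: real
        by (cases "h > 0") (auto simp: max_def)
      then show "\<forall>\<^sub>F h in at 0. norm (max 0 h ^ Suc n / h :: real) \<le> \<bar>h\<bar> ^ n"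
        by simp
    qed
    then show ?thesis
      using 3 assms by (simp add: DERIV_def zero_power)
  qed
qed

text \<open>The cube is the lowest integer power of the truncated paraboloid that is C2, and its
  derivatives are explicit. The kernel is not normalised; its mass is divided out later.\<close>

definition bump :: "real \<Rightarrow> real^'n \<Rightarrow> real" where
  "bump r z = max 0 (r\<^sup>2 - z \<bullet> z) ^ 3"

definition bump_grad :: "real \<Rightarrow> real^'n \<Rightarrow> real^'n" where
  "bump_grad r z = (- 6 * max 0 (r\<^sup>2 - z \<bullet> z) ^ 2) *\<^sub>R z"

definition bump_hess :: "real \<Rightarrow> real^'n \<Rightarrow> real^'n \<Rightarrow> real^'n" where
  "bump_hess r z h = (24 * max 0 (r\<^sup>2 - z \<bullet> z) * (z \<bullet> h)) *\<^sub>R z - (6 * max 0 (r\<^sup>2 - z \<bullet> z) ^ 2) *\<^sub>R h"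

lemma bump_nonneg: "bump r z \<ge> 0"
  by (simp add: bump_def)

lemma bump_eq_0:
  assumes "r \<le> norm z" "r \<ge> 0"
  shows "bump r z = 0"
proof -
  have "r\<^sup>2 \<le> z \<bullet> z"
    using assms by (simp add: power2_norm_eq_inner[symmetric] power_mono)
  then show ?thesis
    by (simp add: bump_def)
qed

lemma continuous_on_bump [continuous_intros]:
  "continuous_on S f \<Longrightarrow> continuous_on S (\<lambda>x. bump r (f x))"
  unfolding bump_def by (intro continuous_intros)

lemma continuous_on_bump_grad [continuous_intros]:
  "continuous_on S f \<Longrightarrow> continuous_on S (\<lambda>x. bump_grad r (f x))"
  unfolding bump_grad_def by (intro continuous_intros)

lemma continuous_on_bump_hess [continuous_intros]:
  "continuous_on S f \<Longrightarrow> continuous_on S (\<lambda>x. bump_hess r (f x) h)"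
  unfolding bump_hess_def by (intro continuous_intros)

lemma has_derivative_max_0_ball_power:
  fixes z :: "real^'n"
  assumes "m = Suc n" "n > 0"
  shows "((\<lambda>z. max 0 (r\<^sup>2 - z \<bullet> z) ^ m) has_derivative
     (\<lambda>h. real m * max 0 (r\<^sup>2 - z \<bullet> z) ^ n * (- 2 * (z \<bullet> h)))) (at z)"
proof -
  have "((\<lambda>z. r\<^sup>2 - z \<bullet> z) has_derivative (\<lambda>h. - 2 * (z \<bullet> h))) (at z)"
    by (rule derivative_eq_intros refl)+ (simp add: fun_eq_iff inner_commute)
  from has_derivative_compose[OF this
      has_real_derivative_max_0_power[OF assms(2), of "r\<^sup>2 - z \<bullet> z", unfolded has_field_derivative_def]]
  show ?thesis
    unfolding assms(1) .
qed

lemma has_derivative_bump: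
  fixes z :: "real^'n"
  shows "(bump r has_derivative (\<lambda>h. bump_grad r z \<bullet> h)) (at z)"
  unfolding bump_def[abs_def] bump_grad_def
  by (rule has_derivative_eq_rhs[OF has_derivative_max_0_ball_power[of 3 2]])
    (simp_all add: fun_eq_iff)

lemma has_derivative_bump_grad:
  fixes z :: "real^'n"
  shows "(bump_grad r has_derivative bump_hess r z) (at z)"
proof -
  have "((\<lambda>z. max 0 (r\<^sup>2 - z \<bullet> z) ^ 2) has_derivative
     (\<lambda>h. - 4 * max 0 (r\<^sup>2 - z \<bullet> z) * (z \<bullet> h))) (at z)"
    by (rule has_derivative_eq_rhs[OF has_derivative_max_0_ball_power[of 2 1]])
      (simp_all add: fun_eq_iff)
  from has_derivative_scaleR[OF has_derivative_mult_right[OF this, of "- 6"] has_derivative_ident]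
  show ?thesis
    unfolding bump_grad_def[abs_def]
    by (rule has_derivative_eq_rhs) (simp add: fun_eq_iff bump_hess_def)
qed

text \<open>A continuous nonnegative function with zero integral over a nondegenerate box vanishes
  on it, but the kernel is positive at 0.\<close>

lemma bump_integral_pos:
  assumes "r > 0"
  shows "integral (cbox (- (r *\<^sub>R One)) (r *\<^sub>R One)) (bump r :: real^'n \<Rightarrow> real) > 0"
proof -
  let ?C = "cbox (- (r *\<^sub>R One)) (r *\<^sub>R One) :: (real^'n) set"
  have cont: "continuous_on ?C (bump r)"
    using continuous_on_bump[OF continuous_on_id] by simp
  have "box (- (r *\<^sub>R One)) (r *\<^sub>R One) \<noteq> ({} :: (real^'n) set)"
    using assms by (simp add: box_ne_empty inner_simps)
  moreover have "(0 :: real^'n) \<in> ?C"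
    using assms by (simp add: mem_box)
  moreover have "bump r (0 :: real^'n) \<noteq> 0"
    using assms by (simp add: bump_def)
  ultimately have "integral ?C (bump r) \<noteq> 0"
    using integral_cbox_eq_0_iff[OF cont] bump_nonneg by metis
  moreover have "integral ?C (bump r) \<ge> 0"
    by (intro integral_nonneg integrable_continuous cont bump_nonneg)
  ultimately show ?thesis
    by simp
qed

text \<open>The Leibniz rule with derivatives as plain functions. In finite dimension, continuity of
  \<open>L\<close> for each fixed \<open>h\<close> already gives continuity in operator
  norm.\<close>

lemma has_derivative_integral_parameter:
  fixes f :: "'a::euclidean_space \<Rightarrow> 'b::euclidean_space \<Rightarrow> 'c::euclidean_space"
  assumes der: "\<And>x t. ((\<lambda>x. f x t) has_derivative L x t) (at x)"
    and contL: "\<And>h. continuous_on UNIV (\<lambda>(x, t). L x t h)"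
    and contf: "\<And>x. continuous_on UNIV (f x)"
  shows "((\<lambda>x. integral (cbox a b) (f x)) has_derivative
     (\<lambda>h. integral (cbox a b) (\<lambda>t. L x t h))) (at x)"
proof -
  have L: "blinfun_apply (Blinfun (L x t)) = L x t" for x t
    using der has_derivative_bounded_linear bounded_linear_Blinfun_apply by blast
  have cont: "continuous_on (UNIV \<times> cbox a b) (\<lambda>(x, t). Blinfun (L x t))"
    unfolding split_def
  proof (rule continuous_on_blinfun_componentwise)
    fix i :: 'a
    show "continuous_on (UNIV \<times> cbox a b) (\<lambda>p. blinfun_apply (Blinfun (L (fst p) (snd p))) i)"
      unfolding L using contL[of i] by (auto simp: split_def intro: continuous_on_subset)
  qed
  have int: "(\<lambda>t. Blinfun (L x t)) integrable_on cbox a b"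
  proof (rule integrable_continuous)
    have "continuous_on (cbox a b) (\<lambda>t. case (x, t) of (x, t) \<Rightarrow> Blinfun (L x t))"
      by (rule continuous_on_compose2[OF cont]) (auto intro!: continuous_intros)
    then show "continuous_on (cbox a b) (\<lambda>t. Blinfun (L x t))"
      by simp
  qed
  have "((\<lambda>x. integral (cbox a b) (f x)) has_derivative
     integral (cbox a b) (\<lambda>t. Blinfun (L x t))) (at x within UNIV)"
    by (rule leibniz_rule[OF _ _ cont])
      (auto simp: L der intro!: integrable_continuous continuous_on_subset[OF contf])
  moreover have "blinfun_apply (integral (cbox a b) (\<lambda>t. Blinfun (L x t)))
      = (\<lambda>h. integral (cbox a b) (\<lambda>t. L x t h))"
    by (simp add: fun_eq_iff blinfun_apply_integral[OF int] L)
  ultimately show ?thesis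
    by simp
qed

text \<open>The domain of integration is fixed and \<open>x\<close> enters only through the kernel,
  so \<open>f\<close> is never differentiated. The minus sign in the gradient comes from
  \<open>t - x\<close> and cancels in the second derivative.\<close>

lemma C2_with_hessian_mollification:
  fixes f :: "real^'n \<Rightarrow> real"
  assumes f: "continuous_on UNIV f"
  shows "C2_with_hessian (\<lambda>x. integral (cbox a b) (\<lambda>t. f t * bump r (t - x)))
     (\<lambda>x. integral (cbox a b) (\<lambda>t. - f t *\<^sub>R bump_grad r (t - x)))
     (\<lambda>x. matrix (\<lambda>h. integral (cbox a b) (\<lambda>t. f t *\<^sub>R bump_hess r (t - x) h)))"
proof (rule C2_with_hessianI)
  note contf = continuous_on_compose2[OF f, continuous_intros]
  have sub: "((\<lambda>x. t - x) has_derivative (\<lambda>h. - h)) (at x)" for t x :: "real^'n"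
    by (auto intro!: derivative_eq_intros)
  have b: "((\<lambda>x. f t * bump r (t - x)) has_derivative (\<lambda>h. (- f t *\<^sub>R bump_grad r (t - x)) \<bullet> h)) (at x)"
    for t x
    using has_derivative_mult_right[OF has_derivative_compose[OF sub has_derivative_bump], of "f t"]
    by simp
  have lin: "linear (bump_hess r z)" for z :: "real^'n"
    using has_derivative_bump_grad has_derivative_linear by blast
  have g: "((\<lambda>x. - f t *\<^sub>R bump_grad r (t - x)) has_derivative (\<lambda>h. f t *\<^sub>R bump_hess r (t - x) h)) (at x)"
    for t x
  proof -
    have "((\<lambda>x. bump_grad r (t - x)) has_derivative (\<lambda>h. bump_hess r (t - x) (- h))) (at x)"
      by (rule has_derivative_compose[OF sub has_derivative_bump_grad])
    from has_derivative_scaleR_right[OF this, of "- f t"] show ?thesis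
      by (simp add: linear_neg[OF lin])
  qed
  fix x :: "real^'n"
  have "integral (cbox a b) (\<lambda>t. (- f t *\<^sub>R bump_grad r (t - x)) \<bullet> h)
      = integral (cbox a b) (\<lambda>t. - f t *\<^sub>R bump_grad r (t - x)) \<bullet> h" for h
  proof -
    have "(\<lambda>t. - f t *\<^sub>R bump_grad r (t - x)) integrable_on cbox a b"
      by (intro integrable_continuous continuous_intros) auto
    from integral_linear[OF this bounded_linear_inner_left] show ?thesis
      by (simp add: o_def)
  qed
  moreover have "((\<lambda>x. integral (cbox a b) (\<lambda>t. f t * bump r (t - x))) has_derivative
      (\<lambda>h. integral (cbox a b) (\<lambda>t. (- f t *\<^sub>R bump_grad r (t - x)) \<bullet> h))) (at x)"
    by (rule has_derivative_integral_parameter[OF b])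
      (auto simp: split_def intro!: continuous_intros)
  ultimately show "((\<lambda>x. integral (cbox a b) (\<lambda>t. f t * bump r (t - x))) has_derivative
      (\<lambda>h. integral (cbox a b) (\<lambda>t. - f t *\<^sub>R bump_grad r (t - x)) \<bullet> h)) (at x)"
    by simp
  show "((\<lambda>x. integral (cbox a b) (\<lambda>t. - f t *\<^sub>R bump_grad r (t - x))) has_derivative
      (\<lambda>h. integral (cbox a b) (\<lambda>t. f t *\<^sub>R bump_hess r (t - x) h))) (at x)"
    by (rule has_derivative_integral_parameter[OF g])
      (auto simp: split_def intro!: continuous_intros)
next
  note contf = continuous_on_compose2[OF f, continuous_intros]
  show "continuous_on UNIV (\<lambda>x. integral (cbox a b) (\<lambda>t. f t *\<^sub>R bump_hess r (t - x) h))" for h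
    by (rule integral_continuous_on_param) (auto simp: split_def intro!: continuous_intros)
qed

text \<open>The even function \<open>\<psi>\<close> has derivative 0 at 0 and second derivative
  \<open>2 * (d \<bullet> (H x *v d))\<close> there. Were this negative, \<open>\<psi>'\<close>
  would be negative just to the right of 0, and the mean value theorem would give
  \<open>\<psi> s < \<psi> 0 = 2 * F x\<close>.\<close>

lemma hessian_nonneg_if_second_difference_nonneg:
  fixes d x :: "real^'n"
  assumes C2: "C2_with_hessian F DF H"
    and "s0 > 0" and diff: "\<And>s. \<bar>s\<bar> < s0 \<Longrightarrow> 2 * F x \<le> F (x + s *\<^sub>R d) + F (x - s *\<^sub>R d)"
  shows "0 \<le> d \<bullet> (H x *v d)"
proof (rule ccontr)
  assume neg: "\<not> ?thesis"
  define \<psi> where "\<psi> s = F (x + s *\<^sub>R d) + F (x - s *\<^sub>R d)" for s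
  define \<psi>' where "\<psi>' s = DF (x + s *\<^sub>R d) \<bullet> d - DF (x - s *\<^sub>R d) \<bullet> d" for s
  have F: "(F has_derivative (\<lambda>h. DF y \<bullet> h)) (at y)" for y
    using C2 by (simp add: C2_with_hessian_def)
  have DF: "(DF has_derivative (\<lambda>h. H y *v h)) (at y)" for y
    using C2 by (simp add: C2_with_hessian_def)
  have lines: "((\<lambda>s. x + s *\<^sub>R d) has_derivative (\<lambda>t. t *\<^sub>R d)) (at s)"
      "((\<lambda>s. x - s *\<^sub>R d) has_derivative (\<lambda>t. - (t *\<^sub>R d))) (at s)" for s
    by (auto intro!: derivative_eq_intros)
  have \<psi>: "(\<psi> has_real_derivative \<psi>' s) (at s)" for s
    unfolding has_field_derivative_def \<psi>_def[abs_def] \<psi>'_def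
    by (rule has_derivative_eq_rhs[OF has_derivative_add[OF has_derivative_compose[OF lines(1) F]
            has_derivative_compose[OF lines(2) F]]])
      (simp add: fun_eq_iff algebra_simps)
  have "(\<psi>' has_derivative (\<lambda>t. (H x *v (t *\<^sub>R d)) \<bullet> d - (H x *v (- (t *\<^sub>R d))) \<bullet> d)) (at 0)"
    unfolding \<psi>'_def[abs_def]
    using has_derivative_diff[OF
        has_derivative_inner_left[OF has_derivative_compose[OF lines(1)[of 0], of DF]]
        has_derivative_inner_left[OF has_derivative_compose[OF lines(2)[of 0], of DF]]] DF[of x]
    by simp
  also have "(\<lambda>t. (H x *v (t *\<^sub>R d)) \<bullet> d - (H x *v (- (t *\<^sub>R d))) \<bullet> d) = (*) (2 * (d \<bullet> (H x *v d)))"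
    by (auto simp: fun_eq_iff matrix_vector_mult_scaleR inner_commute
        simp flip: scaleR_minus_left)
  finally have "(\<psi>' has_real_derivative 2 * (d \<bullet> (H x *v d))) (at 0)"
    by (simp add: has_field_derivative_def)
  then obtain e where e: "e > 0" "\<And>h. 0 < h \<Longrightarrow> h < e \<Longrightarrow> \<psi>' h < \<psi>' 0"
    using DERIV_neg_dec_right[of \<psi>' "2 * (d \<bullet> (H x *v d))" 0] neg by auto
  define s where "s = min e s0 / 2"
  have s: "0 < s" "s < e" "s < s0"
    using e(1) \<open>s0 > 0\<close> by (auto simp: s_def)
  obtain z where z: "0 < z" "z < s" "\<psi> s - \<psi> 0 = (s - 0) * \<psi>' z"
    using MVT2[OF s(1), of \<psi> \<psi>'] \<psi> by blast
  have "\<psi>' z < 0"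
    using e(2)[of z] z s by (simp add: \<psi>'_def)
  then have "\<psi> s < \<psi> 0"
    using z(3) s(1) by (simp add: mult_less_0_iff algebra_simps)
  then show False
    using diff[of s] s by (simp add: \<psi>_def)
qed

text \<open>Midpoint convexity at every translate \<open>x + z\<close>, weighted by the nonnegative
  kernel and integrated over \<open>z\<close>, is midpoint convexity of the convolution at
  \<open>x\<close>; its second differences then determine the sign of the Hessian.\<close>

lemma smooth_approximation_convex_along:
  fixes K \<Omega> Dirs :: "(real^'n) set"
  assumes "open \<Omega>" "compact K" "K \<subseteq> \<Omega>" and u: "continuous_on \<Omega> u"
    and mid: "midpoint_convex_along Dirs \<Omega> u" and "e > 0"
  obtains F DF H where "C2_with_hessian F DF H" "\<And>x. x \<in> K \<Longrightarrow> \<bar>F x - u x\<bar> \<le> e"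
    "\<And>x d. x \<in> K \<Longrightarrow> d \<in> Dirs \<Longrightarrow> 0 \<le> d \<bullet> (H x *v d)"
proof -
  obtain \<rho> where \<rho>: "\<rho> > 0" "compact (\<Union>x\<in>K. cball x \<rho>)" "(\<Union>x\<in>K. cball x \<rho>) \<subseteq> \<Omega>"
    using compact_neighbourhood_in_open[OF assms(2,1,3)] by metis
  define K' where "K' = (\<Union>x\<in>K. cball x \<rho>)"
  have K': "compact K'" "K' \<subseteq> \<Omega>"
    using \<rho> by (auto simp: K'_def)
  have in_K': "y \<in> K'" if "x \<in> K" "dist x y \<le> \<rho>" for x y
    using that by (auto simp: K'_def)
  have uK': "continuous_on K' u"
    using u K'(2) continuous_on_subset by blast
  \<comment> \<open>A continuous extension to the whole space makes every integrand continuous on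
    every box; only its values on \<open>K'\<close>, where it agrees with \<open>u\<close>, affect
    the estimates.\<close>
  obtain f where f: "continuous_on UNIV f" and fu: "\<And>x. x \<in> K' \<Longrightarrow> f x = u x"
    using Tietze_unbounded[of K' u UNIV] uK' compact_imp_closed[OF K'(1)] by auto
  obtain \<delta> where \<delta>: "\<delta> > 0" "\<And>x y. x \<in> K' \<Longrightarrow> y \<in> K' \<Longrightarrow> dist y x < \<delta> \<Longrightarrow> dist (u y) (u x) < e"
    using compact_uniformly_continuous[OF uK' K'(1)] \<open>e > 0\<close> unfolding uniformly_continuous_on_def by blast
  \<comment> \<open>Half of \<rho> leaves room for two displacements of length at most
    \<open>r\<close>: one by \<open>z\<close> in the support of the kernel, one along
    \<open>d\<close>.\<close>
  define r where "r = min \<delta> \<rho> / 2"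
  have r: "r > 0" "r < \<delta>" "2 * r \<le> \<rho>"
    using \<delta>(1) \<rho>(1) by (auto simp: r_def)
  let ?C = "cbox (- (r *\<^sub>R One)) (r *\<^sub>R One) :: (real^'n) set"
  obtain c where c: "K' \<subseteq> cbox (- c) c"
    using bounded_subset_cbox_symmetric[OF compact_imp_bounded[OF K'(1)]] by metis
  \<comment> \<open>One box for all \<open>x\<close> in \<open>K'\<close>: enlarging by
    \<open>r\<close> makes it contain the support of every kernel centred in
    \<open>K'\<close>.\<close>
  define a b where "a = - c - r *\<^sub>R One" and "b = c + r *\<^sub>R One"
  define G where "G x = integral (cbox a b) (\<lambda>t. f t * bump r (t - x))" for x
  note contf = continuous_on_compose2[OF f, continuous_intros]
  \<comment> \<open>Recentring moves the dependence on \<open>x\<close> from the kernel to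
    \<open>f\<close>, so that values of \<open>G\<close> at different points are integrals against
    the same weight.\<close>
  have G: "G x = integral ?C (\<lambda>z. f (x + z) * bump r z)" if "x \<in> K'" for x
  proof -
    let ?D = "cbox (- (r *\<^sub>R One) + x) (r *\<^sub>R One + x)"
    have "- c \<bullet> i \<le> x \<bullet> i \<and> x \<bullet> i \<le> c \<bullet> i" if "i \<in> Basis" for i
      using c \<open>x \<in> K'\<close> that by (auto simp: mem_box)
    then have sub: "?D \<subseteq> cbox a b"
      by (auto simp: mem_box a_def b_def inner_simps) (smt (verit, best))+
    have zero: "f t * bump r (t - x) = 0" if t: "t \<notin> ?D" for t
    proof -
      obtain i where i: "i \<in> Basis" "\<not> (- r + x \<bullet> i \<le> t \<bullet> i \<and> t \<bullet> i \<le> r + x \<bullet> i)"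
        using t by (auto simp: mem_box inner_simps)
      then have "r \<le> \<bar>(t - x) \<bullet> i\<bar>"
        by (auto simp: inner_diff_left)
      also have "\<dots> \<le> norm (t - x)"
        using i(1) by (rule Basis_le_norm)
      finally show ?thesis
        using r(1) by (simp add: bump_eq_0)
    qed
    have "(\<lambda>t. f t * bump r (t - x)) integrable_on ?D"
      by (intro integrable_continuous continuous_intros) auto
    then have "((\<lambda>t. f t * bump r (t - x)) has_integral integral ?D (\<lambda>t. f t * bump r (t - x))) (cbox a b)"
      by (rule has_integral_on_superset[OF integrable_integral zero sub])
    then have "G x = integral ?D (\<lambda>t. f t * bump r (t - x))"
      unfolding G_def by (rule integral_unique)
    also have "\<dots> = integral ?C (\<lambda>z. f (z + x) * bump r (z + x - x))"
      using integral_shift_cbox[of "- (r *\<^sub>R One) + x" x "r *\<^sub>R One + x" "\<lambda>t. f t * bump r (t - x)"] by simp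
    finally show ?thesis
      by (simp add: add.commute)
  qed
  define I where "I = integral ?C (bump r)"
  have I: "I > 0"
    unfolding I_def by (rule bump_integral_pos[OF r(1)])
  have int: "(\<lambda>z. f (x + z) * bump r z) integrable_on ?C" for x
    by (intro integrable_continuous continuous_intros) auto
  have intb: "bump r integrable_on ?C"
    by (intro integrable_continuous continuous_on_bump[OF continuous_on_id])
  have C2: "C2_with_hessian (\<lambda>x. inverse I * G x)
     (\<lambda>x. inverse I *\<^sub>R integral (cbox a b) (\<lambda>t. - f t *\<^sub>R bump_grad r (t - x)))
     (\<lambda>x. inverse I *\<^sub>R matrix (\<lambda>h. integral (cbox a b) (\<lambda>t. f t *\<^sub>R bump_hess r (t - x) h)))"
    unfolding G_def by (rule C2_with_hessian_cmult[OF C2_with_hessian_mollification[OF f]])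
  show thesis
  proof (rule that[OF C2])
    fix x assume x: "x \<in> K"
    have xK': "x \<in> K'"
      using in_K'[OF x, of x] \<rho>(1) by simp
    have "G x - I * u x = integral ?C (\<lambda>z. (f (x + z) - u x) * bump r z)"
      unfolding G[OF xK'] I_def left_diff_distrib
      by (subst integral_diff) (auto intro!: int integrable_on_mult_right intb)
    also have "norm \<dots> \<le> integral ?C (\<lambda>z. e * bump r z)"
    proof (rule integral_norm_bound_integral)
      show "(\<lambda>z. (f (x + z) - u x) * bump r z) integrable_on ?C"
        by (intro integrable_continuous continuous_intros) auto
      show "(\<lambda>z. e * bump r z) integrable_on ?C"
        by (intro integrable_on_mult_right intb)
      fix z :: "real^'n"
      show "norm ((f (x + z) - u x) * bump r z) \<le> e * bump r z"
      proof (cases "norm z < r")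
        case True
        have "x + z \<in> K'"
          by (rule in_K'[OF x]) (use True r in \<open>simp add: dist_norm\<close>)
        then have "\<bar>f (x + z) - u x\<bar> \<le> e"
          using \<delta>(2)[OF xK', of "x + z"] fu True r by (simp add: dist_norm)
        then show ?thesis
          using bump_nonneg[of r z] by (simp add: abs_mult mult_right_mono)
      next
        case False
        then show ?thesis
          using r(1) by (simp add: bump_eq_0)
      qed
    qed
    finally have "\<bar>G x - I * u x\<bar> \<le> e * I"
      by (simp add: I_def)
    then have "\<bar>inverse I * (G x - I * u x)\<bar> \<le> e"
      using I by (simp add: abs_mult field_simps)
    moreover have "inverse I * (G x - I * u x) = inverse I * G x - u x"
      using I by (simp add: right_diff_distrib)
    ultimately show "\<bar>inverse I * G x - u x\<bar> \<le> e"
      by simp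
  next
    fix x d assume x: "x \<in> K" and d: "d \<in> Dirs"
    define s0 where "s0 = r / (1 + norm d)"
    have s0: "s0 > 0"
      using r(1) by (simp add: s0_def add_pos_nonneg)
    show "0 \<le> d \<bullet> ((inverse I *\<^sub>R matrix (\<lambda>h. integral (cbox a b) (\<lambda>t. f t *\<^sub>R bump_hess r (t - x) h))) *v d)"
    proof (rule hessian_nonneg_if_second_difference_nonneg[OF C2 s0])
      fix s assume s: "\<bar>s\<bar> < s0"
      have small: "norm (t *\<^sub>R d) \<le> r" if "\<bar>t\<bar> \<le> \<bar>s\<bar>" for t
      proof -
        have "\<bar>t\<bar> * norm d \<le> s0 * (1 + norm d)"
          using that s by (intro mult_mono) auto
        also have "\<dots> = r"
          unfolding s0_def by (simp add: add_nonneg_eq_0_iff)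
        finally show ?thesis
          by simp
      qed
      have near: "x + z + t *\<^sub>R d \<in> K'" if "norm z \<le> r" "\<bar>t\<bar> \<le> \<bar>s\<bar>" for z t
      proof (rule in_K'[OF x])
        have "dist x (x + z + t *\<^sub>R d) = norm (z + t *\<^sub>R d)"
          by (metis add.assoc add_diff_cancel_left' dist_commute dist_norm)
        also have "\<dots> \<le> norm z + norm (t *\<^sub>R d)"
          by (rule norm_triangle_ineq)
        finally show "dist x (x + z + t *\<^sub>R d) \<le> \<rho>"
          using that(1) small[OF that(2)] r(3) by linarith
      qed
      have "integral ?C (\<lambda>z. 2 * (f (x + z) * bump r z)) \<le>
          integral ?C (\<lambda>z. f (x + s *\<^sub>R d + z) * bump r z + f (x - s *\<^sub>R d + z) * bump r z)"
      proof (rule integral_le)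
        show "(\<lambda>z. 2 * (f (x + z) * bump r z)) integrable_on ?C"
          by (intro integrable_on_mult_right int)
        show "(\<lambda>z. f (x + s *\<^sub>R d + z) * bump r z + f (x - s *\<^sub>R d + z) * bump r z) integrable_on ?C"
          by (intro integrable_add int)
        fix z :: "real^'n"
        show "2 * (f (x + z) * bump r z) \<le> f (x + s *\<^sub>R d + z) * bump r z + f (x - s *\<^sub>R d + z) * bump r z"
        proof (cases "norm z < r")
          case True
          then have near': "x + z + t *\<^sub>R d \<in> K'" if "\<bar>t\<bar> \<le> \<bar>s\<bar>" for t
            using near[of z t] that by simp
          then have "2 * u (x + z) \<le> u (x + z + s *\<^sub>R d) + u (x + z - s *\<^sub>R d)"
            using mid d K'(2) unfolding midpoint_convex_along_def by blast
          then have "2 * f (x + z) \<le> f (x + s *\<^sub>R d + z) + f (x - s *\<^sub>R d + z)"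
            using fu[OF near'[of 0]] fu[OF near'[of s]] fu[OF near'[of "- s"]]
            by (simp add: algebra_simps)
          then show ?thesis
            using mult_right_mono[OF _ bump_nonneg[of r z]] by (fastforce simp: algebra_simps)
        next
          case False
          then show ?thesis
            using r(1) by (simp add: bump_eq_0)
        qed
      qed
      also have "\<dots> = G (x + s *\<^sub>R d) + G (x - s *\<^sub>R d)"
        using near[of 0 s] near[of 0 "- s"] r(1) by (simp add: G integral_add int)
      finally have "2 * G x \<le> G (x + s *\<^sub>R d) + G (x - s *\<^sub>R d)"
        using near[of 0 0] r(1) by (simp add: G)
      then have "inverse I * (2 * G x) \<le> inverse I * (G (x + s *\<^sub>R d) + G (x - s *\<^sub>R d))"
        using I by (intro mult_left_mono) auto
      then show "2 * (inverse I * G x) \<le> inverse I * G (x + s *\<^sub>R d) + inverse I * G (x - s *\<^sub>R d)"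
        by (simp add: algebra_simps)
    qed
  qed
qed

section \<open>Comparison of subsolution and supersolution\<close>

theorem mainTheorem2:
  fixes \<Omega> Dirs :: "(real^'n) set" and g g0 u v :: "real^'n \<Rightarrow> real"
  assumes "open \<Omega>" "connected \<Omega>" "\<Omega> \<noteq> {}" "bounded \<Omega>"
    and "\<Omega> \<subseteq> cbox 0 1"
    and "direction_set Dirs"
    and "continuous_on UNIV g"
    and "continuous_on UNIV g0" "D_convex Dirs g0"
    and "\<forall>x\<in>\<Omega>. g x \<ge> g0 x"
    and "\<forall>x\<in>cbox 0 1 - \<Omega>. g x = g0 x"
    and "usc_on (closure \<Omega>) u" "lsc_on (closure \<Omega>) v"
    and "visc_subsolution Dirs g \<Omega> u"
    and "visc_supersolution Dirs g \<Omega> v"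
    and "\<forall>x\<in>frontier \<Omega>. u x \<le> v x"
  shows "\<forall>x\<in>\<Omega>. u x \<le> v x"
proof (rule ccontr)
  note open_\<Omega> = assms(1) and usc = assms(12) and lsc = assms(13) and sub = assms(14)
    and super = assms(15)
  assume "\<not> (\<forall>x\<in>\<Omega>. u x \<le> v x)"
  then obtain x0 where x0: "x0 \<in> \<Omega>" "u x0 > v x0"
    by force
  have dirs: "span Dirs = UNIV" "0 \<notin> Dirs"
    using assms(6) by (auto simp: direction_set_def)
  have "Dirs \<noteq> {}"
  proof
    assume "Dirs = {}"
    then have "(UNIV :: (real^'n) set) = {0}"
      using dirs(1) by simp
    then have "(1 :: real^'n) = 0"
      by blast
    then show False
      by simp
  qed
  let ?cl = "closure \<Omega>"
  have cl: "compact ?cl" "\<Omega> \<subseteq> ?cl" "?cl \<noteq> {}"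
    using assms(3,4) closure_subset by auto
  have mid: "midpoint_convex_along Dirs \<Omega> u"
    by (rule visc_subsolution_midpoint_convex[OF sub open_\<Omega> dirs(2)])
  have cont_u: "continuous_on \<Omega> u"
    by (rule midpoint_convex_along_continuous[OF open_\<Omega> usc_on_subset[OF usc cl(2)] mid dirs(1)])
  have u_le_g: "u x \<le> g x" if "x \<in> \<Omega>" for x
    by (rule visc_subsolution_le_obstacle[OF sub open_\<Omega> assms(7) that])

  \<comment> \<open>Compactness of the closure bounds \<open>v\<close> and \<open>g\<close> from
    below and the squared norm from above. The unit gap below \<open>g\<close> becomes the margin
    \<epsilon> in \<open>w_le\<close>.\<close>
  obtain R where R: "\<And>x. x \<in> ?cl \<Longrightarrow> x \<bullet> x - R \<le> v x" "\<And>x. x \<in> ?cl \<Longrightarrow> x \<bullet> x - R \<le> g x - 1"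
  proof -
    obtain xv where xv: "\<And>x. x \<in> ?cl \<Longrightarrow> v xv \<le> v x"
      using lsc_on_attains_min[OF lsc cl(1,3)] by blast
    obtain xg where xg: "\<And>x. x \<in> ?cl \<Longrightarrow> g xg \<le> g x"
      using continuous_attains_inf[OF cl(1,3) continuous_on_subset[OF assms(7)]] by auto
    have "continuous_on ?cl (\<lambda>x. x \<bullet> x)"
      by (intro continuous_intros)
    then obtain xs :: "real^'n" where xs: "\<And>x. x \<in> ?cl \<Longrightarrow> x \<bullet> x \<le> xs \<bullet> xs"
      using continuous_attains_sup[OF cl(1,3)] by blast
    show thesis
    proof (rule that[of "xs \<bullet> xs + \<bar>v xv\<bar> + \<bar>g xg\<bar> + 1"])
      fix x assume x: "x \<in> ?cl"
      show "x \<bullet> x - (xs \<bullet> xs + \<bar>v xv\<bar> + \<bar>g xg\<bar> + 1) \<le> v x"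
        "x \<bullet> x - (xs \<bullet> xs + \<bar>v xv\<bar> + \<bar>g xg\<bar> + 1) \<le> g x - 1"
        using xv[OF x] xg[OF x] xs[OF x] by linarith+
    qed
  qed
  \<comment> \<open>A uniformly convex function below both the obstacle and \<open>v\<close>: mixing it into \<open>u\<close> makes the
    subsolution strict without spoiling the boundary inequality.\<close>
  define q where "q x = x \<bullet> x - R" for x :: "real^'n"
  have q: "q x \<le> v x" "q x \<le> g x - 1" if "x \<in> ?cl" for x
    using R[OF that] by (auto simp: q_def)

  \<comment> \<open>At \<epsilon> = 0 the expression equals \<open>u x0 - v x0 > 0\<close>, so it
    stays positive for small positive \<epsilon>.\<close>
  obtain \<epsilon> where \<epsilon>: "0 < \<epsilon>" "\<epsilon> < 1" "(1 - \<epsilon>) * u x0 + \<epsilon> * q x0 - v x0 > 0"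
  proof -
    have "((\<lambda>\<epsilon>. (1 - \<epsilon>) * u x0 + \<epsilon> * q x0 - v x0) \<longlongrightarrow> (1 - 0) * u x0 + 0 * q x0 - v x0) (at_right 0)"
      by (intro tendsto_intros)
    then have "\<forall>\<^sub>F \<epsilon> in at_right 0. (1 - \<epsilon>) * u x0 + \<epsilon> * q x0 - v x0 > 0"
      using x0(2) by (intro order_tendstoD(1)) auto
    moreover have "\<forall>\<^sub>F \<epsilon>::real in at_right 0. \<epsilon> \<in> {0<..<1}"
      by (rule eventually_at_right_real) simp
    ultimately have "\<forall>\<^sub>F \<epsilon> in at_right 0. \<epsilon> \<in> {0<..<1} \<and> (1 - \<epsilon>) * u x0 + \<epsilon> * q x0 - v x0 > 0"
      by eventually_elim simp
    from eventually_happens'[OF trivial_limit_at_right_real this]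
    obtain \<epsilon> where "\<epsilon> \<in> {0<..<1} \<and> (1 - \<epsilon>) * u x0 + \<epsilon> * q x0 - v x0 > 0" ..
    then show thesis
      by (intro that[of \<epsilon>]) auto
  qed
  define w where "w x = (1 - \<epsilon>) * u x + \<epsilon> * q x" for x
  define m where "m = w x0 - v x0"
  have m: "m > 0"
    using \<epsilon>(3) by (simp add: m_def w_def)
  have w_le: "w x \<le> g x - \<epsilon>" if "x \<in> \<Omega>" for x
  proof -
    have "(1 - \<epsilon>) * u x \<le> (1 - \<epsilon>) * g x" "\<epsilon> * q x \<le> \<epsilon> * (g x - 1)"
      using u_le_g[OF that] q(2)[of x] cl(2) that \<epsilon> by (auto intro!: mult_left_mono)
    then show ?thesis
      by (simp add: w_def algebra_simps)
  qed
  have w_frontier: "w x \<le> v x" if "x \<in> frontier \<Omega>" for x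
  proof -
    have "x \<in> ?cl"
      using that by (simp add: frontier_def)
    then have "(1 - \<epsilon>) * u x \<le> (1 - \<epsilon>) * v x" "\<epsilon> * q x \<le> \<epsilon> * v x"
      using assms(16) that q(1)[of x] \<epsilon> by (auto intro!: mult_left_mono)
    then show ?thesis
      by (simp add: w_def algebra_simps)
  qed
  have usc_wv: "usc_on ?cl (\<lambda>x. w x + - v x)"
    unfolding w_def
  proof (intro usc_on_add usc_on_cmult usc)
    show "usc_on ?cl q"
      unfolding q_def[abs_def] by (intro continuous_on_imp_usc_on continuous_intros)
  qed (use \<epsilon> lsc in \<open>auto simp: usc_on_uminus_iff\<close>)
  \<comment> \<open>Any positive level below \<open>m\<close> would separate \<open>K\<close> from
    the frontier, where \<open>w \<le> v\<close>; half of \<open>m\<close> leaves room for the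
    smoothing error.\<close>
  define K where "K = {x \<in> ?cl. m / 2 \<le> w x + - v x}"
  have K: "compact K"
    unfolding K_def by (rule usc_on_compact_superlevel[OF usc_wv cl(1)])
  have K\<Omega>: "K \<subseteq> \<Omega>"
  proof
    fix x assume x: "x \<in> K"
    then have "x \<notin> frontier \<Omega>"
      using w_frontier[of x] m by (auto simp: K_def)
    then show "x \<in> \<Omega>"
      using x open_\<Omega> by (auto simp: K_def frontier_def interior_open)
  qed
  \<comment> \<open>The enlargement guarantees that a maximiser over \<open>K'\<close> which lies in
    \<open>K\<close> has a full ball of radius \<open>r\<close> in \<open>K'\<close>, hence is a
    local extremum in \<Omega>.\<close>
  obtain r where r: "r > 0" "compact (\<Union>x\<in>K. cball x r)" "(\<Union>x\<in>K. cball x r) \<subseteq> \<Omega>"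
    using compact_neighbourhood_in_open[OF K open_\<Omega> K\<Omega>] by metis
  define K' where "K' = (\<Union>x\<in>K. cball x r)"
  have K': "compact K'" "K' \<subseteq> \<Omega>" "K' \<subseteq> ?cl"
    using r(2,3) cl(2) by (auto simp: K'_def)
  have x0K: "x0 \<in> K"
    using x0 cl(2) m by (auto simp: K_def m_def)
  then have x0K': "x0 \<in> K'"
    using r(1) by (force simp: K'_def)

  \<comment> \<open>The error enters twice, at \<open>x0\<close> and at the maximiser, and
    \<open>m - 2 * (m / 5)\<close> still exceeds the level \<open>m / 2\<close> of
    \<open>K\<close>.\<close>
  have "m / 5 > 0"
    using m by simp
  obtain F DF HF where F: "C2_with_hessian F DF HF" "\<And>x. x \<in> K' \<Longrightarrow> \<bar>F x - u x\<bar> \<le> m / 5"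
      "\<And>x d. x \<in> K' \<Longrightarrow> d \<in> Dirs \<Longrightarrow> 0 \<le> d \<bullet> (HF x *v d)"
    using smooth_approximation_convex_along[OF open_\<Omega> K'(1,2) cont_u mid \<open>m / 5 > 0\<close>] by metis
  \<comment> \<open>A smooth version of \<open>w\<close> up to the constant
    \<open>\<epsilon> * R\<close>, which changes neither the contact points nor the Hessian. The
    factor 1 and the shift by 0 match the general paraboloid.\<close>
  define \<Phi> where "\<Phi> x = (1 - \<epsilon>) * F x + \<epsilon> * (1 * ((x - 0) \<bullet> (x - 0)))" for x
  define H\<Phi> where "H\<Phi> x = (1 - \<epsilon>) *\<^sub>R HF x + \<epsilon> *\<^sub>R (2 * 1) *\<^sub>R mat 1" for x
  obtain D\<Phi> where C2: "C2_with_hessian \<Phi> D\<Phi> H\<Phi>"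
    using C2_with_hessian_add[OF C2_with_hessian_cmult[OF F(1), of "1 - \<epsilon>"]
        C2_with_hessian_cmult[OF C2_with_hessian_paraboloid[of 1 0], of \<epsilon>]]
    unfolding \<Phi>_def[abs_def] H\<Phi>_def[abs_def] by blast
  have \<Phi>w: "\<bar>\<Phi> x - \<epsilon> * R - w x\<bar> \<le> m / 5" if "x \<in> K'" for x
  proof -
    have "\<Phi> x - \<epsilon> * R - w x = (1 - \<epsilon>) * (F x - u x)"
      by (simp add: \<Phi>_def w_def q_def algebra_simps)
    also have "\<bar>\<dots>\<bar> \<le> 1 * (m / 5)"
      unfolding abs_mult using F(2)[OF that] \<epsilon> by (intro mult_mono) auto
    finally show ?thesis
      by simp
  qed
  have "usc_on K' (\<lambda>x. \<Phi> x + - v x)"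
  proof (rule usc_on_add[OF continuous_on_imp_usc_on])
    have "(\<Phi> has_derivative (\<lambda>h. D\<Phi> x \<bullet> h)) (at x)" for x
      using C2 by (simp add: C2_with_hessian_def)
    then show "continuous_on K' \<Phi>"
      by (meson continuous_at_imp_continuous_on has_derivative_continuous)
    show "usc_on K' (\<lambda>x. - v x)"
      by (rule usc_on_subset[OF lsc[folded usc_on_uminus_iff] K'(3)])
  qed
  then obtain y where y: "y \<in> K'" "\<And>z. z \<in> K' \<Longrightarrow> \<Phi> z - v z \<le> \<Phi> y - v y"
    using usc_on_attains_max[OF _ K'(1)] x0K' by fastforce
  have "m / 2 \<le> w y - v y"
    using y(2)[OF x0K'] \<Phi>w[OF x0K'] \<Phi>w[OF y(1)] m unfolding m_def by argo
  then have yK: "y \<in> K"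
    using y(1) K'(3) by (auto simp: K_def)
  then have y\<Omega>: "y \<in> \<Omega>"
    using K\<Omega> by blast
  have "v y - \<Phi> y \<le> v z - \<Phi> z" if "dist z y < r" for z
  proof -
    have "z \<in> K'"
      using that yK by (force simp: K'_def dist_commute)
    then show ?thesis
      using y(2) by force
  qed
  then have "local_min_on \<Omega> (\<lambda>z. v z - \<Phi> z) y"
    unfolding local_min_on_def using r(1) by blast
  then have "v y - g y \<ge> 0 \<or> - lambdaD Dirs (H\<Phi> y) \<ge> 0"
    using super C2 y\<Omega> unfolding visc_supersolution_def by blast
  moreover have "2 * \<epsilon> \<le> lambdaD Dirs (H\<Phi> y)"
  proof (rule lambdaD_ge[OF \<open>Dirs \<noteq> {}\<close> dirs(2)])
    fix d assume d: "d \<in> Dirs"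
    have "H\<Phi> y *v d = (1 - \<epsilon>) *\<^sub>R (HF y *v d) + \<epsilon> *\<^sub>R (2 *\<^sub>R d)"
      unfolding H\<Phi>_def matrix_vector_mult_add_rdistrib scaleR_matrix_vector_assoc[symmetric]
      by simp
    then have "d \<bullet> (H\<Phi> y *v d) = (1 - \<epsilon>) * (d \<bullet> (HF y *v d)) + 2 * \<epsilon> * (norm d)\<^sup>2"
      by (simp add: inner_add_right power2_norm_eq_inner)
    moreover have "(1 - \<epsilon>) * (d \<bullet> (HF y *v d)) \<ge> 0"
      using F(3)[OF y(1) d] \<epsilon> by simp
    ultimately show "2 * \<epsilon> * (norm d)\<^sup>2 \<le> d \<bullet> (H\<Phi> y *v d)"
      by linarith
  qed
  \<comment> \<open>The curvature alternative is excluded, since \<open>lambdaD\<close> is at least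
    \<open>2 * \<epsilon>\<close> here. The remaining one contradicts
    \<open>v y < w y \<le> g y - \<epsilon>\<close>, in which \<open>w\<close> itself appears and
    not its smoothing.\<close>
  ultimately have "v y \<ge> g y"
    using \<epsilon>(1) by linarith
  then show False
    using w_le[OF y\<Omega>] \<open>m / 2 \<le> w y - v y\<close> m \<epsilon>(1) by linarith
qed

end
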